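(* Let $f\in C^{2}([0,\infty))$ be convex with $f(0)>0$, $f'\ge0$ and $\lim_{s\to\infty}f(s)/s=\infty$. Assume that one of the following holds: (i) for some $\epsilon>0$ there exists $T=T_\epsilon>0$ such that $$f'(t)\,f\Big(t-\frac{f(t)}{f'(t)}\Big)\ge\epsilon t\quad\text{for all } t>T;$$ (ii) for some $0<\gamma<2$ there exist constants $C_\gamma>0$ and $T=T_\gamma>1$ such that $$\frac{f''(t)}{f(t)}\ge\frac{C_\gamma}{t^2(\ln t)^\gamma}\quad\text{for all } t>T.$$ Then, in every dimension $n\ge2$, there is a constant $C$ independent of $u$ such that $\|u\|_{H^1_0(\Omega)}\le C$ for every positive semistable solution $u$ of $Lu+f(u)=0$ in $\Omega$, $u=0$ on $\partial\Omega$.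
   Context: Setting: $n\ge 2$, $\Omega\subset\mathbb{R}^n$ is a smooth bounded domain, and $Lu:=\partial_i(a^{ij}(x)u_j)$ (summation over repeated indices, $u_j=\partial_j u$), where $a^{ij}=a^{ji}\in L^\infty(\Omega)$ and there are constants $c_0,C_0>0$ with $c_0|\xi|^2\le a^{ij}(x)\xi_i\xi_j\le C_0|\xi|^2$ for all $\xi\in\mathbb{R}^n$, $x\in\Omega$. A solution is a weak solution $u\in H^1_0(\Omega)\cap L^\infty(\Omega)$. It is semistable if $\int_\Omega f'(u)\eta^2\,dx\le\int_\Omega a^{ij}(x)\eta_i\eta_j\,dx$ for all $\eta\in H^1_0(\Omega)$. "Independent of $u$" means that the constant depends only on $\Omega$, $n$, $L$, $f$ and the parameters in the statement, not on the particular solution $u$. In (i), $T$ is such that $f'(t)>0$ and $t-f(t)/f'(t)\ge0$ for $t>T$, so that the expression is defined. *)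

theory Defs
  imports "HOL-Analysis.Analysis"
begin

section \<open>Smooth functions and smooth bounded domains\<close>

text \<open>
  On an open set, \<open>Ck_on k f S\<close> says that \<open>f\<close> is \<open>k\<close> times continuously differentiable
  on \<open>S\<close>, phrased through iterated partial derivatives in the directions of \<open>Basis\<close>.
\<close>

primrec Ck_on ::
  "nat \<Rightarrow> ('a::euclidean_space \<Rightarrow> 'b::real_normed_vector) \<Rightarrow> 'a set \<Rightarrow> bool" where
  "Ck_on 0 f S \<longleftrightarrow> continuous_on S f"
| "Ck_on (Suc k) f S \<longleftrightarrow>
     (\<forall>x\<in>S. f differentiable (at x)) \<and>
     (\<forall>b\<in>Basis. Ck_on k (\<lambda>x. frechet_derivative f (at x) b) S)"

definition smooth_on ::
  "('a::euclidean_space \<Rightarrow> 'b::real_normed_vector) \<Rightarrow> 'a set \<Rightarrow> bool" where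
  "smooth_on f S \<longleftrightarrow> (\<forall>k. Ck_on k f S)"

text \<open>
  The boundary can be straightened locally by smooth diffeomorphisms. Since the index type
  carries no order, the coordinate playing the role of the last one is existentially quantified.
\<close>

definition smooth_boundary :: "(real^'n) set \<Rightarrow> bool" where
  "smooth_boundary \<Omega> \<longleftrightarrow>
     (\<forall>x0\<in>frontier \<Omega>. \<exists>r>0. \<exists>D \<psi> \<theta> i. open D \<and>
        homeomorphism (ball x0 r) D \<psi> \<theta> \<and> smooth_on \<psi> (ball x0 r) \<and> smooth_on \<theta> D \<and>
        \<psi> ` (ball x0 r \<inter> \<Omega>) = D \<inter> {y::real^'n. y $ i > 0} \<and>
        \<psi> ` (ball x0 r \<inter> frontier \<Omega>) = D \<inter> {y::real^'n. y $ i = 0})"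

definition smooth_bounded_domain :: "(real^'n) set \<Rightarrow> bool" where
  "smooth_bounded_domain \<Omega> \<longleftrightarrow>
     open \<Omega> \<and> connected \<Omega> \<and> \<Omega> \<noteq> {} \<and> bounded \<Omega> \<and> smooth_boundary \<Omega>"

section \<open>Function spaces\<close>

text \<open>
  Elements of Lebesgue and Sobolev spaces are represented by functions on the whole space, of
  which only the almost everywhere class on \<open>\<Omega>\<close> matters.
\<close>

definition L2 :: "(real^'n) set \<Rightarrow> (real^'n \<Rightarrow> real) set" where
  "L2 \<Omega> = {u. u \<in> borel_measurable (lebesgue_on \<Omega>) \<and>
              integrable (lebesgue_on \<Omega>) (\<lambda>x. (u x)\<^sup>2)}"

definition Linf :: "(real^'n) set \<Rightarrow> (real^'n \<Rightarrow> real) set" where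
  "Linf \<Omega> = {u. u \<in> borel_measurable (lebesgue_on \<Omega>) \<and>
                (\<exists>M. AE x in lebesgue_on \<Omega>. \<bar>u x\<bar> \<le> M)}"

definition test_functions :: "(real^'n) set \<Rightarrow> (real^'n \<Rightarrow> real) set" where
  "test_functions \<Omega> = {\<phi>. smooth_on \<phi> UNIV \<and>
     compact (closure {x. \<phi> x \<noteq> 0}) \<and> closure {x. \<phi> x \<noteq> 0} \<subseteq> \<Omega>}"

definition locally_integrable_on :: "(real^'n \<Rightarrow> real) \<Rightarrow> (real^'n) set \<Rightarrow> bool"
    (infix "locally'_integrable'_on" 50) where
  "u locally_integrable_on \<Omega> \<longleftrightarrow> (\<forall>K. compact K \<and> K \<subseteq> \<Omega> \<longrightarrow> set_integrable lebesgue K u)"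

definition has_weak_gradient ::
  "(real^'n) set \<Rightarrow> (real^'n \<Rightarrow> real) \<Rightarrow> (real^'n \<Rightarrow> real^'n) \<Rightarrow> bool" where
  "has_weak_gradient \<Omega> u g \<longleftrightarrow>
     u locally_integrable_on \<Omega> \<and>
     (\<forall>i. (\<lambda>x. g x $ i) locally_integrable_on \<Omega> \<and>
       (\<forall>\<phi>\<in>test_functions \<Omega>.
          (LINT x|lebesgue_on \<Omega>. u x * frechet_derivative \<phi> (at x) (axis i 1)) =
          - (LINT x|lebesgue_on \<Omega>. g x $ i * \<phi> x)))"

text \<open>
  Any two weak gradients agree almost everywhere on \<open>\<Omega>\<close>; the choice below picks a
  representative.
\<close>

definition weak_gradient ::
  "(real^'n) set \<Rightarrow> (real^'n \<Rightarrow> real) \<Rightarrow> real^'n \<Rightarrow> real^'n" where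
  "weak_gradient \<Omega> u = (SOME g. has_weak_gradient \<Omega> u g)"

definition H1 :: "(real^'n) set \<Rightarrow> (real^'n \<Rightarrow> real) set" where
  "H1 \<Omega> = {u. u \<in> L2 \<Omega> \<and> (\<exists>g. has_weak_gradient \<Omega> u g \<and> (\<forall>i. (\<lambda>x. g x $ i) \<in> L2 \<Omega>))}"

definition H1_norm :: "(real^'n) set \<Rightarrow> (real^'n \<Rightarrow> real) \<Rightarrow> real" where
  "H1_norm \<Omega> u = sqrt ((LINT x|lebesgue_on \<Omega>. (u x)\<^sup>2) +
                         (LINT x|lebesgue_on \<Omega>. (norm (weak_gradient \<Omega> u x))\<^sup>2))"

text \<open>The closure of the test functions in \<open>H1\<close>, with the norm inherited from \<open>H1\<close>.\<close>

definition H10 :: "(real^'n) set \<Rightarrow> (real^'n \<Rightarrow> real) set" where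
  "H10 \<Omega> = {u \<in> H1 \<Omega>. \<exists>\<phi>. (\<forall>k::nat. \<phi> k \<in> test_functions \<Omega>) \<and>
                          (\<lambda>k. H1_norm \<Omega> (\<lambda>x. u x - \<phi> k x)) \<longlonglongrightarrow> 0}"

section \<open>The operator, weak solutions and semistability\<close>

text \<open>
  \<open>a x\<close> is the matrix with entries \<open>a\<^sup>i\<^sup>j(x)\<close>, so that \<open>a\<^sup>i\<^sup>j(x) \<xi>\<^sub>i \<xi>\<^sub>j\<close> is
  \<open>\<xi> \<bullet> (a x *v \<xi>)\<close>. As the coefficients are elements of \<open>L\<^sup>\<infinity>\<close>, their pointwise
  properties are required almost everywhere.
\<close>

definition elliptic_coeffs :: "(real^'n) set \<Rightarrow> (real^'n \<Rightarrow> real^'n^'n) \<Rightarrow> bool" where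
  "elliptic_coeffs \<Omega> a \<longleftrightarrow>
     (\<forall>i j. (\<lambda>x. a x $ i $ j) \<in> Linf \<Omega>) \<and>
     (AE x in lebesgue_on \<Omega>. \<forall>i j. a x $ i $ j = a x $ j $ i) \<and>
     (\<exists>c0>0. \<exists>C0>0. AE x in lebesgue_on \<Omega>. \<forall>\<xi>.
        c0 * (norm \<xi>)\<^sup>2 \<le> \<xi> \<bullet> (a x *v \<xi>) \<and> \<xi> \<bullet> (a x *v \<xi>) \<le> C0 * (norm \<xi>)\<^sup>2)"

text \<open>Weak formulation of \<open>\<partial>\<^sub>i(a\<^sup>i\<^sup>j u\<^sub>j) + f(u) = 0\<close> with zero boundary values.\<close>

definition weak_solution ::
  "(real^'n) set \<Rightarrow> (real^'n \<Rightarrow> real^'n^'n) \<Rightarrow> (real \<Rightarrow> real) \<Rightarrow> (real^'n \<Rightarrow> real) \<Rightarrow> bool" where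
  "weak_solution \<Omega> a f u \<longleftrightarrow>
     u \<in> H10 \<Omega> \<and> u \<in> Linf \<Omega> \<and>
     (\<forall>\<eta>\<in>H10 \<Omega>.
        (LINT x|lebesgue_on \<Omega>. weak_gradient \<Omega> \<eta> x \<bullet> (a x *v weak_gradient \<Omega> u x)) =
        (LINT x|lebesgue_on \<Omega>. f (u x) * \<eta> x))"

text \<open>The argument \<open>f'\<close> is the derivative of the nonlinearity.\<close>

definition semistable ::
  "(real^'n) set \<Rightarrow> (real^'n \<Rightarrow> real^'n^'n) \<Rightarrow> (real \<Rightarrow> real) \<Rightarrow> (real^'n \<Rightarrow> real) \<Rightarrow> bool" where
  "semistable \<Omega> a f' u \<longleftrightarrow>
     (\<forall>\<eta>\<in>H10 \<Omega>.
        (LINT x|lebesgue_on \<Omega>. f' (u x) * (\<eta> x)\<^sup>2) \<le>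
        (LINT x|lebesgue_on \<Omega>. weak_gradient \<Omega> \<eta> x \<bullet> (a x *v weak_gradient \<Omega> \<eta> x)))"

text \<open>
  \<open>f\<close> is twice continuously differentiable on \<open>[0,\<infinity>)\<close> with derivatives \<open>f'\<close> and \<open>f''\<close>,
  one-sided at \<open>0\<close>; values on the negative axis are irrelevant.
\<close>

definition C2_nonneg :: "(real \<Rightarrow> real) \<Rightarrow> (real \<Rightarrow> real) \<Rightarrow> (real \<Rightarrow> real) \<Rightarrow> bool" where
  "C2_nonneg f f' f'' \<longleftrightarrow>
     (\<forall>t\<ge>0. (f has_real_derivative f' t) (at t within {0..})) \<and>
     (\<forall>t\<ge>0. (f' has_real_derivative f'' t) (at t within {0..})) \<and>
     continuous_on {0..} f''"

end

theory Submission
  imports Defs "HOL-Real_Asymp.Real_Asymp"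
begin

text \<open>
  Let \<open>u\<close> be a positive semistable solution, and let \<open>g\<close> be a function on \<open>[0,\<infinity>)\<close> with
  \<open>g 0 = 0\<close>; put \<open>h t = \<integral>\<^sub>0\<^sup>t g'\<^sup>2\<close>. Since \<open>\<nabla>(g(u)) = g'(u) \<nabla>u\<close> and
  \<open>\<nabla>(h(u)) = g'(u)\<^sup>2 \<nabla>u\<close>, the energy of \<open>g(u)\<close> in the semistability inequality is the left side
  of the weak equation tested with \<open>h(u)\<close>. Eliminating it leaves
  \<open>\<integral> (f'(u) g(u)\<^sup>2 - f(u) h(u)) \<le> 0\<close>, an inequality without derivatives of \<open>u\<close>. So it
  suffices to find, for the given \<open>f\<close>, a profile \<open>g\<close> with
  \<open>f' g\<^sup>2 - f h \<ge> \<delta> t f(t) - C\<close> on \<open>[0,\<infinity>)\<close>: then \<open>\<integral> u f(u)\<close> is bounded. Testing the equation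
  with \<open>u\<close> itself bounds the Dirichlet energy by the same integral, and \<open>f(t)/t \<rightarrow> \<infinity>\<close>
  gives \<open>t\<^sup>2 \<le> t f(t) + C\<close>, hence the \<open>L\<^sup>2\<close> bound
  (\<open>H1_bound_if_coercive_profile\<close>).

  Under the first condition \<open>g = f - f 0\<close> works. Here
  \<open>f' g\<^sup>2 - f h = g (F - f 0 f') + f 0 F\<close> with \<open>F t = \<integral>\<^sub>0\<^sup>t f'' g\<close>. As \<open>f' \<rightarrow> \<infinity>\<close>, \<open>F\<close> eventually
  dominates \<open>f 0 f'\<close>, and bounding \<open>f\<close> from below by its tangent at \<open>t\<close>, which vanishes at
  \<open>z = t - f t / f' t\<close>, gives \<open>\<integral>\<^sub>z\<^sup>t f'' f \<ge> f' t * f z \<ge> \<epsilon> t\<close>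
  (\<open>coercive_profile_tangent_condition\<close>).

  Under the second condition \<open>g t = t ln (1 + t)\<close> works. With \<open>L = ln (1 + t)\<close> one has
  \<open>h \<le> t L\<^sup>2 + t\<close>, so that \<open>f' g\<^sup>2 - f h \<ge> t (L\<^sup>2 (t f' - f) - f)\<close>, and the lower bound on \<open>f''\<close>
  yields \<open>t f' - f \<ge> c f / (ln t)\<^sup>\<gamma>\<close> up to constants. The exponent \<open>\<gamma> < 2\<close> is exactly what
  makes \<open>L\<^sup>2\<close> win (\<open>coercive_profile_log_condition\<close>).

  The analytic work is to justify the test functions \<open>g(u)\<close> and \<open>h(u)\<close> in \<open>H10\<close>. For smooth
  \<open>p\<close> with bounded derivative and \<open>p 0 = 0\<close> the compositions \<open>p \<circ> \<phi>\<^sub>k\<close> of approximating test functions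
  are again test functions and converge to \<open>p \<circ> u\<close> in \<open>H1\<close> (\<open>H10_compose\<close>). A profile is only
  continuously differentiable, but \<open>u\<close> is bounded, and on the range of \<open>u\<close> the derivative \<open>g'\<close> is a
  uniform limit of bounded smooth functions; approximating it costs an error of at most \<open>1\<close> in
  the pointwise inequality, whatever the bound of \<open>u\<close> is (\<open>smooth_profile\<close>).
\<close>

section \<open>Calculus of smooth functions\<close>

text \<open>The recursion for \<^const>\<open>Ck_on\<close> speaks about \<^const>\<open>frechet_derivative\<close>; this
  introduction rule allows any explicit derivative instead.\<close>

lemma Ck_on_Suc_UNIV_I:
  assumes "\<And>x. (f has_derivative D x) (at x)" "\<And>b. b \<in> Basis \<Longrightarrow> Ck_on k (\<lambda>x. D x b) UNIV"
  shows "Ck_on (Suc k) f UNIV"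
proof -
  have "frechet_derivative f (at x) = D x" for x
    using frechet_derivative_at[OF assms(1)] by simp
  then show ?thesis using assms by (auto simp: differentiable_def)
qed

lemma Ck_on_SucD: "Ck_on (Suc k) f S \<Longrightarrow> Ck_on k f S"
proof (induction k arbitrary: f)
  case 0
  then show ?case
    by (auto intro!: differentiable_imp_continuous_on differentiable_at_imp_differentiable_on)
qed auto

lemma Ck_on_continuous: "Ck_on k f S \<Longrightarrow> continuous_on S f"
  by (cases k) (auto intro!: differentiable_imp_continuous_on differentiable_at_imp_differentiable_on)

lemma Ck_on_Suc_has_derivative:
  "Ck_on (Suc k) f UNIV \<Longrightarrow> (f has_derivative frechet_derivative f (at x)) (at x)"
  by (simp add: frechet_derivative_works)

lemma Ck_on_Suc_frechet:
  "Ck_on (Suc k) f S \<Longrightarrow> b \<in> Basis \<Longrightarrow> Ck_on k (\<lambda>x. frechet_derivative f (at x) b) S"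
  by simp

lemma Ck_on_const: "Ck_on k (\<lambda>x. c) UNIV"
proof (induction k arbitrary: c)
  case (Suc k)
  show ?case by (rule Ck_on_Suc_UNIV_I[where D="\<lambda>x h. 0"]) (use Suc in auto)
qed simp

lemma Ck_on_bounded_linear: "bounded_linear f \<Longrightarrow> Ck_on k f UNIV"
proof (induction k)
  case 0
  then show ?case by (simp add: linear_continuous_on)
next
  case (Suc k)
  show ?case
    by (rule Ck_on_Suc_UNIV_I[where D="\<lambda>x. f"])
      (use Suc in \<open>auto intro: bounded_linear_imp_has_derivative Ck_on_const\<close>)
qed

lemma Ck_on_add: "Ck_on k f UNIV \<Longrightarrow> Ck_on k g UNIV \<Longrightarrow> Ck_on k (\<lambda>x. f x + g x) UNIV"
proof (induction k arbitrary: f g)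
  case (Suc k)
  show ?case
  proof (rule Ck_on_Suc_UNIV_I)
    show "((\<lambda>x. f x + g x) has_derivative
        (\<lambda>h. frechet_derivative f (at x) h + frechet_derivative g (at x) h)) (at x)" for x
      by (intro has_derivative_add Ck_on_Suc_has_derivative[OF Suc.prems(1)]
          Ck_on_Suc_has_derivative[OF Suc.prems(2)])
  qed (use Suc in auto)
qed (auto intro: continuous_on_add)

lemma Ck_on_mult:
  fixes f g :: "'a::euclidean_space \<Rightarrow> real"
  shows "Ck_on k f UNIV \<Longrightarrow> Ck_on k g UNIV \<Longrightarrow> Ck_on k (\<lambda>x. f x * g x) UNIV"
proof (induction k arbitrary: f g)
  case (Suc k)
  show ?case
  proof (rule Ck_on_Suc_UNIV_I)
    show "((\<lambda>x. f x * g x) has_derivative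
        (\<lambda>h. f x * frechet_derivative g (at x) h + frechet_derivative f (at x) h * g x)) (at x)" for x
      by (intro has_derivative_mult Ck_on_Suc_has_derivative[OF Suc.prems(1)]
          Ck_on_Suc_has_derivative[OF Suc.prems(2)])
    show "Ck_on k (\<lambda>x. f x * frechet_derivative g (at x) b + frechet_derivative f (at x) b * g x) UNIV"
      if "b \<in> Basis" for b
      using Suc.prems that Suc.prems[THEN Ck_on_SucD] by (intro Ck_on_add Suc.IH) auto
  qed
qed (auto intro: continuous_on_mult)

text \<open>By the chain rule the derivative is a product of \<open>p' \<circ> f\<close>, to which the induction hypothesis
  applies with \<open>p'\<close> in place of \<open>p\<close>, and a derivative of \<open>f\<close>.\<close>

lemma Ck_on_compose:
  fixes f :: "'a::euclidean_space \<Rightarrow> real" and p :: "real \<Rightarrow> real"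
  shows "Ck_on k p UNIV \<Longrightarrow> Ck_on k f UNIV \<Longrightarrow> Ck_on k (\<lambda>x. p (f x)) UNIV"
proof (induction k arbitrary: p f)
  case 0
  then show ?case using continuous_on_compose2[of UNIV p UNIV f] by auto
next
  case (Suc k)
  let ?p = "\<lambda>t. frechet_derivative p (at t) 1"
  have lin: "frechet_derivative p (at t) h = ?p t * h" for t h
    using linear_cmul[OF has_derivative_linear[OF Ck_on_Suc_has_derivative[OF Suc.prems(1)]], of t h 1]
    by (simp add: mult.commute)
  have "((\<lambda>x. p (f x)) has_derivative (\<lambda>h. ?p (f x) * frechet_derivative f (at x) h)) (at x)" for x
    using has_derivative_compose[OF Ck_on_Suc_has_derivative[OF Suc.prems(2)]
      Ck_on_Suc_has_derivative[OF Suc.prems(1)], of x]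
    by (rule has_derivative_eq_rhs) (rule ext, rule lin)
  moreover have "Ck_on k (\<lambda>x. ?p (f x) * frechet_derivative f (at x) b) UNIV" if "b \<in> Basis" for b
    using Suc.prems that
    by (intro Ck_on_mult Suc.IH[of ?p f] Ck_on_SucD[OF Suc.prems(2)]) auto
  ultimately show ?case by (rule Ck_on_Suc_UNIV_I)
qed

lemma Ck_on_prod:
  fixes f :: "'i \<Rightarrow> 'a::euclidean_space \<Rightarrow> real"
  assumes "\<And>i. i \<in> I \<Longrightarrow> Ck_on k (f i) UNIV"
  shows "Ck_on k (\<lambda>x. \<Prod>i\<in>I. f i x) UNIV"
  using assms by (induction I rule: infinite_finite_induct) (auto intro: Ck_on_mult Ck_on_const)

lemma Ck_on_Suc_DERIV_I:
  fixes f :: "real \<Rightarrow> real"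
  assumes "\<And>t. (f has_real_derivative f' t) (at t)" "Ck_on k f' UNIV"
  shows "Ck_on (Suc k) f UNIV"
  by (rule Ck_on_Suc_UNIV_I[OF assms(1)[unfolded has_field_derivative_def]]) (use assms in auto)

lemma smooth_on_DERIV_I:
  fixes f :: "real \<Rightarrow> real"
  assumes "\<And>t. (f has_real_derivative f' t) (at t)" "smooth_on f' UNIV"
  shows "smooth_on f UNIV"
  unfolding smooth_on_def
  by (rule allI, rule Ck_on_SucD, rule Ck_on_Suc_DERIV_I[OF assms(1)],
    rule assms(2)[unfolded smooth_on_def, rule_format])

lemma smooth_on_compose:
  fixes f :: "'a::euclidean_space \<Rightarrow> real" and p :: "real \<Rightarrow> real"
  assumes "smooth_on p UNIV" "smooth_on f UNIV"
  shows "smooth_on (\<lambda>x. p (f x)) UNIV"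
  unfolding smooth_on_def
  by (intro allI Ck_on_compose[of _ p f] assms[unfolded smooth_on_def, rule_format])

lemma smooth_on_mult:
  fixes f g :: "'a::euclidean_space \<Rightarrow> real"
  shows "smooth_on f UNIV \<Longrightarrow> smooth_on g UNIV \<Longrightarrow> smooth_on (\<lambda>x. f x * g x) UNIV"
  unfolding smooth_on_def by (intro allI Ck_on_mult[of _ f g]) auto

lemma smooth_on_add:
  "smooth_on f UNIV \<Longrightarrow> smooth_on g UNIV \<Longrightarrow> smooth_on (\<lambda>x. f x + g x) UNIV"
  unfolding smooth_on_def by (intro allI Ck_on_add[of _ f g]) auto

lemma smooth_on_const: "smooth_on (\<lambda>x. c) UNIV"
  unfolding smooth_on_def by (intro allI Ck_on_const)

lemma smooth_on_bounded_linear: "bounded_linear f \<Longrightarrow> smooth_on f UNIV"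
  unfolding smooth_on_def by (intro allI Ck_on_bounded_linear)

lemma smooth_on_prod:
  fixes f :: "'i \<Rightarrow> 'a::euclidean_space \<Rightarrow> real"
  shows "(\<And>i. i \<in> I \<Longrightarrow> smooth_on (f i) UNIV) \<Longrightarrow> smooth_on (\<lambda>x. \<Prod>i\<in>I. f i x) UNIV"
  unfolding smooth_on_def by (intro allI Ck_on_prod[of I _ f]) auto

lemma smooth_on_continuous: "smooth_on f S \<Longrightarrow> continuous_on S f"
  unfolding smooth_on_def by (rule Ck_on_continuous) (erule spec)

lemma smooth_on_has_derivative:
  "smooth_on f UNIV \<Longrightarrow> (f has_derivative frechet_derivative f (at x)) (at x)"
  unfolding smooth_on_def by (rule Ck_on_Suc_has_derivative) (erule spec)

lemma smooth_on_frechet: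
  "smooth_on f S \<Longrightarrow> b \<in> Basis \<Longrightarrow> smooth_on (\<lambda>x. frechet_derivative f (at x) b) S"
  unfolding smooth_on_def by (blast intro: Ck_on_Suc_frechet)

text \<open>Sine and cosine have to be treated together, each being a multiple of the derivative of the other.\<close>

lemma smooth_on_sin: "smooth_on (sin :: real \<Rightarrow> real) UNIV"
proof -
  have "Ck_on k (sin :: real \<Rightarrow> real) UNIV \<and> Ck_on k (cos :: real \<Rightarrow> real) UNIV" for k
  proof (induction k)
    case (Suc k)
    have "Ck_on k (\<lambda>t::real. -1 * sin t) UNIV"
      using Suc by (intro Ck_on_mult Ck_on_const) auto
    with Suc show ?case
      by (intro conjI Ck_on_Suc_DERIV_I[OF DERIV_sin] Ck_on_Suc_DERIV_I[OF DERIV_cos]) auto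
  qed (auto intro: continuous_intros)
  then show ?thesis unfolding smooth_on_def by blast
qed

text \<open>For \<open>p = 1\<close> this is the standard smooth function vanishing to infinite order at \<open>0\<close>;
  the polynomial factor makes the family closed under differentiation, so that smoothness
  of all its members follows by one induction.\<close>

definition flat_exp :: "real poly \<Rightarrow> real \<Rightarrow> real" where
  "flat_exp p t = (if t > 0 then poly p (inverse t) * exp (- inverse t) else 0)"

lemma poly_times_exp_minus_tendsto_0:
  fixes p :: "real poly"
  shows "((\<lambda>y. poly p y * exp (- y)) \<longlongrightarrow> 0) at_top"
proof -
  have "((\<lambda>y. \<Sum>i\<le>degree p. coeff p i * (y ^ i / exp y)) \<longlongrightarrow> (\<Sum>i\<le>degree p. coeff p i * 0)) at_top"
    by (intro tendsto_sum tendsto_mult tendsto_const tendsto_power_div_exp_0)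
  then show ?thesis
    by (simp add: poly_altdef sum_distrib_right exp_minus divide_inverse mult.assoc)
qed

lemma DERIV_flat_exp:
  "(flat_exp p has_real_derivative flat_exp ([:0,0,1:] * (p - pderiv p)) t) (at t)"
proof -
  let ?q = "[:0,0,1:] * (p - pderiv p)"
  consider "t > 0" | "t < 0" | "t = 0" by linarith
  then show ?thesis
  proof cases
    case 1
    have "((\<lambda>t. poly p (inverse t) * exp (- inverse t)) has_real_derivative flat_exp ?q t) (at t)"
      using 1 by (auto intro!: derivative_eq_intros simp: flat_exp_def algebra_simps power2_eq_square)
    moreover have "eventually (\<lambda>s. s \<in> {0<..}) (nhds t)"
      using 1 by (intro eventually_nhds_in_open) auto
    then have "\<forall>\<^sub>F s in nhds t. poly p (inverse s) * exp (- inverse s) = flat_exp p s"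
      by eventually_elim (auto simp: flat_exp_def)
    ultimately show ?thesis by (subst DERIV_cong_ev[symmetric, OF refl _ refl])
  next
    case 2
    have "eventually (\<lambda>s. s \<in> {..<0}) (nhds t)"
      using 2 by (intro eventually_nhds_in_open) auto
    then have "\<forall>\<^sub>F s in nhds t. 0 = flat_exp p s"
      by eventually_elim (auto simp: flat_exp_def)
    moreover have "((\<lambda>t. 0) has_real_derivative flat_exp ?q t) (at t)"
      using 2 by (auto simp: flat_exp_def)
    ultimately show ?thesis by (subst DERIV_cong_ev[symmetric, OF refl _ refl])
  next
    case 3
    have "((\<lambda>h. flat_exp p h / h) \<longlongrightarrow> 0) (at_right 0)"
    proof -
      have "((\<lambda>h. poly ([:0,1:] * p) (inverse h) * exp (- inverse h)) \<longlongrightarrow> 0) (at_right (0::real))"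
        by (rule filterlim_compose[OF poly_times_exp_minus_tendsto_0 filterlim_inverse_at_top_right])
      then show ?thesis
        by (rule Lim_transform_eventually)
          (rule eventually_mono[OF eventually_at_right_less], simp add: flat_exp_def divide_inverse)
    qed
    moreover have "((\<lambda>h. flat_exp p h / h) \<longlongrightarrow> 0) (at_left 0)"
      by (rule Lim_transform_eventually[OF tendsto_const])
         (auto simp: flat_exp_def eventually_at_left_field intro!: exI[of _ "-1"])
    ultimately have "((\<lambda>h. flat_exp p h / h) \<longlongrightarrow> 0) (at 0)"
      by (rule filterlim_split_at[rotated])
    then show ?thesis using 3 by (simp add: DERIV_def flat_exp_def)
  qed
qed

lemma smooth_on_flat_exp: "smooth_on (flat_exp p) UNIV"
proof -
  have "Ck_on k (flat_exp p) UNIV" for k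
  proof (induction k arbitrary: p)
    case 0
    show ?case
      by (simp, rule DERIV_continuous_on, rule has_field_derivative_at_within, rule DERIV_flat_exp)
  next
    case (Suc k)
    show ?case by (rule Ck_on_Suc_DERIV_I[OF DERIV_flat_exp Suc])
  qed
  then show ?thesis unfolding smooth_on_def by blast
qed

section \<open>Test functions\<close>

text \<open>For \<open>k \<rightarrow> \<infinity>\<close> the factors \<open>exp (- 1 / (k s))\<close> increase to \<open>1\<close> for \<open>s > 0\<close>, so these
  functions converge to the indicator of the open box while their supports stay in the closed one.
  The shift to \<open>Suc k\<close> avoids the degenerate case \<open>k = 0\<close>.\<close>

definition box_bump :: "real^'n \<Rightarrow> real^'n \<Rightarrow> nat \<Rightarrow> real^'n \<Rightarrow> real" where
  "box_bump a b k x =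
     (\<Prod>i\<in>UNIV. flat_exp [:1:] (real (Suc k) * (x $ i - a $ i)) *
                flat_exp [:1:] (real (Suc k) * (b $ i - x $ i)))"

lemma smooth_on_box_bump:
  fixes a b :: "real^'n"
  shows "smooth_on (box_bump a b k) UNIV"
proof -
  have 1: "smooth_on (\<lambda>x::real^'n. c * x $ i + d) UNIV" for c d :: real and i
    by (intro smooth_on_add smooth_on_const smooth_on_bounded_linear bounded_linear_const_mult
        bounded_linear_vec_nth)
  have "smooth_on (\<lambda>x::real^'n. real (Suc k) * (x $ i - a $ i)) UNIV"
       "smooth_on (\<lambda>x::real^'n. real (Suc k) * (b $ i - x $ i)) UNIV" for i
    using 1[of "real (Suc k)" i "- (real (Suc k) * a $ i)"]
      1[of "- real (Suc k)" i "real (Suc k) * b $ i"]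
    by (simp_all add: algebra_simps)
  then show ?thesis unfolding box_bump_def
    by (intro smooth_on_prod smooth_on_mult[OF smooth_on_compose[OF smooth_on_flat_exp]
        smooth_on_compose[OF smooth_on_flat_exp]])
qed

lemma flat_exp_one_bounds: "0 \<le> flat_exp [:1:] t" "flat_exp [:1:] t \<le> 1"
  by (auto simp: flat_exp_def)

lemma box_bump_bounds: "0 \<le> box_bump a b k x" "box_bump a b k x \<le> 1"
  unfolding box_bump_def
  by (auto intro!: prod_nonneg prod_le_1 mult_le_one simp: flat_exp_one_bounds)

lemma box_bump_eq_0_iff: "box_bump a b k x = 0 \<longleftrightarrow> x \<notin> box a b"
proof -
  have "flat_exp [:1:] (real (Suc k) * s) = 0 \<longleftrightarrow> \<not> 0 < s" for s
    by (auto simp: flat_exp_def zero_less_mult_iff simp del: of_nat_Suc)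
  then show ?thesis by (auto simp: box_bump_def mem_box_cart simp del: of_nat_Suc)
qed

lemma box_bump_tendsto_indicator:
  fixes x :: "real^'n"
  shows "(\<lambda>k. box_bump a b k x) \<longlonglongrightarrow> indicator (box a b) x"
proof (cases "x \<in> box a b")
  case True
  have lim: "(\<lambda>k. flat_exp [:1:] (real (Suc k) * c)) \<longlonglongrightarrow> 1" if "c > 0" for c
  proof -
    have "(\<lambda>k. exp (- (inverse (real (Suc k)) * inverse c))) \<longlonglongrightarrow> exp (- (0 * inverse c))"
      by (intro tendsto_intros LIMSEQ_inverse_real_of_nat)
    then show ?thesis using that by (simp add: flat_exp_def)
  qed
  have "(\<lambda>k. box_bump a b k x) \<longlonglongrightarrow> (\<Prod>i\<in>(UNIV::'n set). 1 * 1)"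
    unfolding box_bump_def by (intro tendsto_prod tendsto_mult lim) (use True in \<open>auto simp: mem_box_cart\<close>)
  then show ?thesis using True by simp
next
  case False
  then have "box_bump a b k x = 0" for k using box_bump_eq_0_iff by blast
  then show ?thesis using False by simp
qed

lemma box_bump_test_function:
  assumes "cbox a b \<subseteq> \<Omega>"
  shows "box_bump a b k \<in> test_functions \<Omega>"
proof -
  have "{x. box_bump a b k x \<noteq> 0} = box a b" by (auto simp: box_bump_eq_0_iff)
  moreover have "closure (box a b) \<subseteq> cbox a b"
    by (rule closure_minimal) (auto simp: box_subset_cbox)
  ultimately show ?thesis
    using assms smooth_on_box_bump compact_closure[of "box a b"] bounded_box[of a b]
    unfolding test_functions_def by auto
qed

text \<open>The classical gradient, in the coordinates used by \<^const>\<open>has_weak_gradient\<close>.\<close>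

definition grad :: "(real^'n \<Rightarrow> real) \<Rightarrow> real^'n \<Rightarrow> real^'n" where
  "grad \<phi> x = (\<chi> i. frechet_derivative \<phi> (at x) (axis i 1))"

lemma grad_nth: "grad \<phi> x $ i = frechet_derivative \<phi> (at x) (axis i 1)"
  by (simp add: grad_def)

lemma smooth_on_grad_nth: "smooth_on \<phi> UNIV \<Longrightarrow> smooth_on (\<lambda>x. grad \<phi> x $ i) UNIV"
  unfolding grad_nth by (rule smooth_on_frechet) auto

lemma grad_eqI: "(\<phi> has_derivative D) (at x) \<Longrightarrow> grad \<phi> x $ i = D (axis i 1)"
  using frechet_derivative_at unfolding grad_nth by metis

lemma grad_mult:
  assumes "smooth_on \<phi> UNIV" "smooth_on \<psi> UNIV"
  shows "grad (\<lambda>x. \<phi> x * \<psi> x) x $ i = \<phi> x * grad \<psi> x $ i + grad \<phi> x $ i * \<psi> x"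
  using grad_eqI[OF has_derivative_mult[OF assms[THEN smooth_on_has_derivative]]]
  by (simp add: grad_nth)

lemma grad_compose:
  assumes "smooth_on \<phi> UNIV" "\<And>t. (p has_real_derivative p' t) (at t)"
  shows "grad (\<lambda>x. p (\<phi> x)) x $ i = p' (\<phi> x) * grad \<phi> x $ i"
  using grad_eqI[OF has_derivative_compose[OF smooth_on_has_derivative[OF assms(1)]
     assms(2)[unfolded has_field_derivative_def]]]
  by (simp add: grad_nth)

lemma test_function_smooth: "\<phi> \<in> test_functions \<Omega> \<Longrightarrow> smooth_on \<phi> UNIV"
  by (simp add: test_functions_def)

lemma test_function_support:
  assumes "\<phi> \<in> test_functions \<Omega>"
  obtains K where "compact K" "K \<subseteq> \<Omega>" "\<And>x. x \<notin> K \<Longrightarrow> \<phi> x = 0" "\<And>x i. x \<notin> K \<Longrightarrow> grad \<phi> x $ i = 0"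
proof -
  let ?K = "closure {x. \<phi> x \<noteq> 0}"
  have 0: "\<phi> x = 0" if "x \<notin> ?K" for x
    using that closure_subset[of "{x. \<phi> x \<noteq> 0}"] by auto
  have "grad \<phi> x $ i = 0" if "x \<notin> ?K" for x i
  proof -
    have "(\<phi> has_derivative (\<lambda>h. 0)) (at x)"
    proof (rule has_derivative_transform_within_open)
      show "((\<lambda>x. 0) has_derivative (\<lambda>h. 0)) (at x)" by (rule has_derivative_const)
      show "open (- ?K)" by (rule open_Compl[OF closed_closure])
      show "x \<in> - ?K" using that by blast
      show "0 = \<phi> y" if "y \<in> - ?K" for y using 0[OF ComplD[OF that]] by (rule sym)
    qed
    then show ?thesis by (rule grad_eqI)
  qed
  moreover have "compact ?K" "?K \<subseteq> \<Omega>" using assms by (auto simp: test_functions_def)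
  ultimately show thesis using 0 by (intro that[of ?K])
qed

lemma test_function_mult:
  assumes "\<phi> \<in> test_functions \<Omega>" "smooth_on \<psi> UNIV"
  shows "(\<lambda>x. \<psi> x * \<phi> x) \<in> test_functions \<Omega>"
proof -
  have "{x. \<psi> x * \<phi> x \<noteq> 0} \<subseteq> {x. \<phi> x \<noteq> 0}" by auto
  then have "closure {x. \<psi> x * \<phi> x \<noteq> 0} \<subseteq> closure {x. \<phi> x \<noteq> 0}" by (rule closure_mono)
  moreover from this have "compact (closure {x. \<psi> x * \<phi> x \<noteq> 0})"
    using assms(1) unfolding test_functions_def
    by (metis (mono_tags, lifting) closed_closure compact_Int_closed inf.absorb_iff2 mem_Collect_eq)
  moreover have "smooth_on (\<lambda>x. \<psi> x * \<phi> x) UNIV"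
    by (rule smooth_on_mult[OF assms(2) test_function_smooth[OF assms(1)]])
  ultimately show ?thesis using assms(1) by (auto simp: test_functions_def)
qed

lemma test_function_compose:
  assumes "\<phi> \<in> test_functions \<Omega>" "smooth_on p UNIV" "p 0 = 0"
  shows "(\<lambda>x. p (\<phi> x)) \<in> test_functions \<Omega>"
proof -
  have "{x. p (\<phi> x) \<noteq> 0} \<subseteq> {x. \<phi> x \<noteq> 0}" using assms(3) by auto
  then have "closure {x. p (\<phi> x) \<noteq> 0} \<subseteq> closure {x. \<phi> x \<noteq> 0}" by (rule closure_mono)
  moreover from this have "compact (closure {x. p (\<phi> x) \<noteq> 0})"
    using assms(1) unfolding test_functions_def
    by (metis (mono_tags, lifting) closed_closure compact_Int_closed inf.absorb_iff2 mem_Collect_eq)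
  moreover have "smooth_on (\<lambda>x. p (\<phi> x)) UNIV"
    by (rule smooth_on_compose[OF assms(2) test_function_smooth[OF assms(1)]])
  ultimately show ?thesis using assms(1) by (auto simp: test_functions_def)
qed

lemma test_function_grad_bound:
  assumes "\<phi> \<in> test_functions \<Omega>"
  obtains B where "\<And>x. \<bar>\<phi> x\<bar> \<le> B" "\<And>x. \<bar>grad \<phi> x $ i\<bar> \<le> B"
proof -
  obtain K where K: "compact K" "\<And>x. x \<notin> K \<Longrightarrow> \<phi> x = 0" "\<And>x i. x \<notin> K \<Longrightarrow> grad \<phi> x $ i = 0"
    using test_function_support[OF assms] by metis
  have bdd: "\<exists>B. \<forall>x. \<bar>f x\<bar> \<le> B" if "continuous_on UNIV f" "\<And>x. x \<notin> K \<Longrightarrow> f x = 0"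
    for f :: "real^'a \<Rightarrow> real"
  proof -
    have "bounded (f ` K)"
      using that(1) K(1) by (meson compact_continuous_image compact_imp_bounded continuous_on_subset subset_UNIV)
    then obtain B where "B > 0" "\<forall>x\<in>K. norm (f x) \<le> B" unfolding bounded_pos by auto
    then have "\<bar>f x\<bar> \<le> B" for x using that(2)[of x] by (cases "x \<in> K") auto
    then show ?thesis by blast
  qed
  have "\<exists>B. \<forall>x. \<bar>\<phi> x\<bar> \<le> B"
    by (rule bdd[OF smooth_on_continuous[OF test_function_smooth[OF assms]] K(2)])
  moreover have "\<exists>B. \<forall>x. \<bar>grad \<phi> x $ i\<bar> \<le> B"
    by (rule bdd[OF smooth_on_continuous[OF smooth_on_grad_nth[OF test_function_smooth[OF assms]]] K(3)])
  ultimately obtain B1 B2 where "\<forall>x. \<bar>\<phi> x\<bar> \<le> B1" "\<forall>x. \<bar>grad \<phi> x $ i\<bar> \<le> B2" by blast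
  then have "\<bar>\<phi> x\<bar> \<le> max B1 B2" "\<bar>grad \<phi> x $ i\<bar> \<le> max B1 B2" for x
    by (auto intro: order_trans[OF _ max.cobounded1] order_trans[OF _ max.cobounded2])
  then show ?thesis by (rule that)
qed

text \<open>Integration by parts without Fubini: the integral is translation invariant, so the
  difference quotients of a test function integrate to zero, and by the mean value theorem they
  converge to the derivative boundedly with supports in a fixed ball.\<close>

lemma integral_grad_test_function_lborel:
  fixes \<phi> :: "real^'n \<Rightarrow> real"
  assumes "\<phi> \<in> test_functions \<Omega>"
  shows "(LINT x|lborel. grad \<phi> x $ i) = 0"
proof -
  let ?e = "axis i 1 :: real^'n"
  \<comment> \<open>the difference quotient with increment \<open>1 / (n + 1)\<close>\<close>
  define q where "q n x = (\<phi> (inverse (real (Suc n)) *\<^sub>R ?e + x) - \<phi> x) * real (Suc n)" for n x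
  note smooth = test_function_smooth[OF assms]
  have cont: "continuous_on UNIV \<phi>" by (rule smooth_on_continuous[OF smooth])
  have [measurable]: "\<phi> \<in> borel_measurable borel" using cont by (rule borel_measurable_continuous_onI)
  have [measurable]: "(\<lambda>x. grad \<phi> x $ i) \<in> borel_measurable borel"
    by (intro borel_measurable_continuous_onI smooth_on_continuous smooth_on_grad_nth smooth)
  obtain K where K: "compact K" "\<And>x. x \<notin> K \<Longrightarrow> \<phi> x = 0" "\<And>x i. x \<notin> K \<Longrightarrow> grad \<phi> x $ i = 0"
    using test_function_support[OF assms] by metis
  obtain R where R: "\<And>x. x \<in> K \<Longrightarrow> norm x \<le> R" using K(1) by (meson bounded_iff compact_imp_bounded)
  obtain B where B: "\<And>x. \<bar>\<phi> x\<bar> \<le> B" "\<And>x. \<bar>grad \<phi> x $ i\<bar> \<le> B"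
    using test_function_grad_bound[OF assms] by metis
  have line: "((\<lambda>s. \<phi> (s *\<^sub>R ?e + x)) has_real_derivative grad \<phi> (s *\<^sub>R ?e + x) $ i) (at s)" for s x
  proof -
    have "((\<lambda>s. \<phi> (s *\<^sub>R ?e + x)) has_derivative
        (\<lambda>h. frechet_derivative \<phi> (at (s *\<^sub>R ?e + x)) (h *\<^sub>R ?e))) (at s)"
      by (rule has_derivative_compose[OF _ smooth_on_has_derivative[OF smooth]])
        (auto intro!: derivative_eq_intros)
    moreover have "frechet_derivative \<phi> (at y) (h *\<^sub>R ?e) = grad \<phi> y $ i * h" for y h
      using linear_cmul[OF has_derivative_linear[OF smooth_on_has_derivative[OF smooth]]]
      by (simp add: grad_nth mult.commute)
    ultimately show ?thesis by (simp add: has_field_derivative_def mult_commute_abs)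
  qed
  have int_phi: "integrable lborel \<phi>"
    by (rule integrableI_bounded_set[where A=K and B=B])
      (use K B emeasure_compact_finite[OF K(1)] in \<open>auto simp: compact_imp_closed\<close>)
  have int_shift: "integrable lborel (\<lambda>x. \<phi> (c + x))" and shift: "(LINT x|lborel. \<phi> (c + x)) = (LINT x|lborel. \<phi> x)" for c
  proof -
    have "integrable (distr lborel borel ((+) c)) \<phi>" using int_phi by (simp add: lborel_distr_plus)
    then show "integrable lborel (\<lambda>x. \<phi> (c + x))" by (subst (asm) integrable_distr_eq) auto
    have "(LINT x|distr lborel borel ((+) c). \<phi> x) = (LINT x|lborel. \<phi> (c + x))"
      by (rule integral_distr) auto
    then show "(LINT x|lborel. \<phi> (c + x)) = (LINT x|lborel. \<phi> x)" by (simp add: lborel_distr_plus)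
  qed
  have q0: "(LINT x|lborel. q n x) = 0" for n
    unfolding q_def by (simp add: int_phi int_shift shift)
  have qB: "norm (q n x) \<le> indicator (cball 0 (R + 1)) x * B" for n x
  proof -
    let ?h = "inverse (real (Suc n))"
    have h: "0 < ?h" "?h \<le> 1" by (auto simp: inverse_le_1_iff)
    have "\<exists>z. 0 < z \<and> z < ?h \<and> \<phi> (?h *\<^sub>R ?e + x) - \<phi> (0 *\<^sub>R ?e + x) = (?h - 0) * grad \<phi> (z *\<^sub>R ?e + x) $ i"
      using MVT2[OF h(1), of "\<lambda>s. \<phi> (s *\<^sub>R ?e + x)" "\<lambda>s. grad \<phi> (s *\<^sub>R ?e + x) $ i"] line by blast
    then obtain z where z: "0 < z" "z < ?h" and
      "\<phi> (?h *\<^sub>R ?e + x) - \<phi> (0 *\<^sub>R ?e + x) = (?h - 0) * grad \<phi> (z *\<^sub>R ?e + x) $ i" by blast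
    then have qz: "q n x = grad \<phi> (z *\<^sub>R ?e + x) $ i" unfolding q_def by simp
    show ?thesis
    proof (cases "x \<in> cball 0 (R + 1)")
      case True then show ?thesis using B(2) qz by simp
    next
      case False
      have "norm x \<le> norm (z *\<^sub>R ?e + x) + norm (z *\<^sub>R ?e)" using norm_triangle_ineq4[of "z *\<^sub>R ?e + x" "z *\<^sub>R ?e"] by simp
      then have "norm (z *\<^sub>R ?e + x) > R" using False z h by (simp add: norm_axis_1)
      then have "z *\<^sub>R ?e + x \<notin> K" using R by fastforce
      then show ?thesis using qz K(3) False by simp
    qed
  qed
  have lim: "(\<lambda>n. q n x) \<longlonglongrightarrow> grad \<phi> x $ i" for x
  proof -
    have "((\<lambda>h. (\<phi> (h *\<^sub>R ?e + x) - \<phi> x) / h) \<longlongrightarrow> grad \<phi> x $ i) (at 0)"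
      using line[of x 0] by (simp add: DERIV_def)
    then have "(\<lambda>n. (\<phi> (inverse (real (Suc n)) *\<^sub>R ?e + x) - \<phi> x) / inverse (real (Suc n))) \<longlonglongrightarrow> grad \<phi> x $ i"
      by (rule filterlim_compose) (auto simp: filterlim_at intro: LIMSEQ_inverse_real_of_nat simp del: of_nat_Suc)
    then show ?thesis by (simp add: q_def divide_inverse)
  qed
  have "(\<lambda>n. LINT x|lborel. q n x) \<longlonglongrightarrow> (LINT x|lborel. grad \<phi> x $ i)"
  proof (rule integral_dominated_convergence[where w="\<lambda>x. indicator (cball 0 (R + 1)) x * B"])
    show "integrable lborel (\<lambda>x. indicator (cball 0 (R + 1)) x * B :: real)"
      using emeasure_compact_finite[OF compact_cball[of 0 "R + 1"]]
      by (intro integrable_mult_left integrable_real_indicator) auto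
    show "q n \<in> borel_measurable lborel" for n unfolding q_def by measurable
  qed (use lim qB in auto)
  then show ?thesis unfolding q0 by (rule LIMSEQ_unique[OF _ tendsto_const])
qed

lemma smooth_on_borel_measurable_lebesgue:
  fixes f :: "real^'n \<Rightarrow> real"
  assumes "smooth_on f UNIV"
  shows "f \<in> borel_measurable lebesgue"
proof (rule measurable_completion)
  show "f \<in> borel_measurable lborel"
    using borel_measurable_continuous_onI[OF smooth_on_continuous[OF assms]] by simp
qed

lemma integral_lebesgue_on_open:
  fixes f :: "real^'n \<Rightarrow> real"
  assumes "open \<Omega>" "\<And>x. x \<notin> \<Omega> \<Longrightarrow> f x = 0"
  shows "(LINT x|lebesgue_on \<Omega>. f x) = (LINT x|lebesgue. f x)"
proof -
  have "(\<lambda>x. indicator \<Omega> x *\<^sub>R f x) = f" using assms(2) by (auto simp: indicator_def fun_eq_iff)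
  then show ?thesis using assms(1) by (simp add: integral_restrict_space)
qed

lemma integral_grad_test_function:
  fixes \<phi> :: "real^'n \<Rightarrow> real"
  assumes "open \<Omega>" "\<phi> \<in> test_functions \<Omega>"
  shows "(LINT x|lebesgue_on \<Omega>. grad \<phi> x $ i) = 0"
proof -
  have "(\<lambda>x. grad \<phi> x $ i) \<in> borel_measurable borel"
    by (intro borel_measurable_continuous_onI smooth_on_continuous smooth_on_grad_nth
        test_function_smooth[OF assms(2)])
  then have z: "(LINT x|lebesgue. grad \<phi> x $ i) = 0"
    using integral_grad_test_function_lborel[OF assms(2)] by (simp add: integral_completion)
  obtain K where "K \<subseteq> \<Omega>" and K: "\<And>x i. x \<notin> K \<Longrightarrow> grad \<phi> x $ i = 0"
    using test_function_support[OF assms(2)] by metis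
  then have "grad \<phi> x $ i = 0" if "x \<notin> \<Omega>" for x
    using that by (intro K) auto
  then have "(LINT x|lebesgue_on \<Omega>. grad \<phi> x $ i) = (LINT x|lebesgue. grad \<phi> x $ i)"
    by (rule integral_lebesgue_on_open[OF assms(1)])
  then show ?thesis using z by (rule trans)
qed

section \<open>The fundamental lemma of the calculus of variations\<close>

text \<open>Open boxes form an intersection-stable generator of the Borel sets, so all set integrals
  of \<open>f\<close> vanish. The support condition makes the integral over the whole space one of the
  integrals over boxes, which the complement step needs.\<close>

lemma AE_eq_0_if_box_integrals_0:
  fixes f :: "'a::euclidean_space \<Rightarrow> real"
  assumes f: "integrable lebesgue f" and supp: "\<And>x. x \<notin> box c d \<Longrightarrow> f x = 0"
    and zero: "\<And>a b. (LINT x:box a b|lebesgue. f x) = 0"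
  shows "AE x in lebesgue. f x = 0"
proof -
  have leb: "A \<in> sets lebesgue" if "A \<in> sets borel" for A :: "'a set" using that by simp
  have si: "set_integrable lebesgue A f" if "A \<in> sets borel" for A
    unfolding set_integrable_def using leb[OF that] f by (rule integrable_mult_indicator)
  have tot: "(LINT x|lebesgue. f x) = 0"
  proof -
    have "(\<lambda>x. indicator (box c d) x *\<^sub>R f x) = f" using supp by (auto simp: indicator_def fun_eq_iff)
    then show ?thesis using zero[of c d] by (simp add: set_lebesgue_integral_def)
  qed
  let ?G = "range (\<lambda>(a, b). box a b :: 'a set)"
  have G: "sets borel = sigma_sets UNIV ?G" by (subst borel_eq_box) simp
  have "Int_stable ?G"
    by (auto simp: Int_stable_def box_Int_box)
  have Z: "(LINT x:A|lebesgue. f x) = 0" if "A \<in> sets borel" for A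
    using \<open>Int_stable ?G\<close> subset_Pow_Union[of ?G, THEN order_trans, OF Pow_mono[OF subset_UNIV]] that[unfolded G]
  proof (induction A rule: sigma_sets_induct_disjoint)
    case (basic A) then show ?case using zero by auto
  next
    case empty show ?case by (simp add: set_lebesgue_integral_def)
  next
    case (compl A)
    then have A: "A \<in> sets borel" using G by simp
    have "(LINT x:UNIV|lebesgue. f x) = (LINT x:A \<union> (UNIV - A)|lebesgue. f x)" by simp
    also have "\<dots> = (LINT x:A|lebesgue. f x) + (LINT x:UNIV - A|lebesgue. f x)"
      by (rule set_integral_Un) (use A in \<open>auto intro!: si\<close>)
    finally show ?case using tot compl by (simp add: set_lebesgue_integral_def)
  next
    case (union A)
    then have A: "A i \<in> sets borel" for i using G by auto
    have "(\<Union>i. A i) \<in> sets borel" using A by auto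
    have "(\<lambda>i. LINT x:A i|lebesgue. f x) sums (LINT x:(\<Union>i. A i)|lebesgue. f x)"
    proof -
      have "(LINT x:(\<Union>i. A i)|lebesgue. f x) = (\<Sum>i. (LINT x:A i|lebesgue. f x))"
        by (rule lebesgue_integral_countable_add)
          (use A union(1) si[OF \<open>(\<Union>i. A i) \<in> sets borel\<close>] in \<open>auto simp: disjoint_family_on_def\<close>)
      then show ?thesis using union by simp
    qed
    then show ?case using union by (simp add: sums_iff)
  qed
  \<comment> \<open>pass to a Borel representative, whose densities are unique with respect to \<^const>\<open>lborel\<close>\<close>
  obtain g where g: "g \<in> borel_measurable lborel" "AE x in lborel. f x = g x"
    using completion_ex_borel_measurable_real[OF borel_measurable_integrable[OF f]] by blast
  have fg: "AE x in lebesgue. f x = g x" by (rule AE_completion[OF g(2)])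
  have [measurable]: "g \<in> borel_measurable borel" using g(1) by simp
  have "integrable lebesgue g"
    by (rule integrable_cong_AE_imp[OF f]) (use fg g(1) in \<open>auto intro: measurable_completion\<close>)
  then have "integrable lborel g" using g(1) by (simp add: integrable_completion)
  moreover have "(LINT x:A|lborel. g x) = 0" if A[measurable]: "A \<in> sets lborel" for A
  proof -
    have "(LINT x:A|lborel. g x) = (LINT x:A|lebesgue. g x)"
      unfolding set_lebesgue_integral_def by (rule integral_completion[symmetric]) measurable
    also have "\<dots> = (LINT x:A|lebesgue. f x)"
      unfolding set_lebesgue_integral_def
    proof (rule integral_cong_AE)
      show "(\<lambda>x. indicat_real A x *\<^sub>R g x) \<in> borel_measurable lebesgue"
        by (rule measurable_completion) measurable
      show "(\<lambda>x. indicat_real A x *\<^sub>R f x) \<in> borel_measurable lebesgue"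
        using si[of A] A unfolding set_integrable_def by auto
    qed (use fg in auto)
    finally show ?thesis using Z A by simp
  qed
  ultimately have "AE x in lborel. g x = 0" by (rule sigma_finite_measure.density_zero[OF sigma_finite_lborel])
  with fg show ?thesis using AE_completion by force
qed

text \<open>The bumps turn vanishing against test functions into vanishing of the integrals over boxes
  whose closure lies in \<open>\<Omega>\<close>; countably many such boxes cover \<open>\<Omega>\<close>.\<close>

lemma AE_eq_0_if_test_integrals_0:
  fixes v :: "real^'n \<Rightarrow> real"
  assumes "open \<Omega>" and v: "v locally_integrable_on \<Omega>"
    and zero: "\<And>\<phi>. \<phi> \<in> test_functions \<Omega> \<Longrightarrow> (LINT x|lebesgue_on \<Omega>. v x * \<phi> x) = 0"
  shows "AE x in lebesgue_on \<Omega>. v x = 0"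
proof -
  have box0: "(LINT x:box a b|lebesgue. v x) = 0" if ab: "cbox a b \<subseteq> \<Omega>" for a b
  proof -
    have int: "integrable lebesgue (\<lambda>x. indicator (cbox a b) x *\<^sub>R v x)"
      using v ab unfolding locally_integrable_on_def set_integrable_def by auto
    have "(\<lambda>k. LINT x|lebesgue. box_bump a b k x * (indicator (cbox a b) x *\<^sub>R v x)) \<longlonglongrightarrow>
        (LINT x|lebesgue. indicator (box a b) x * (indicator (cbox a b) x *\<^sub>R v x))"
    proof (rule integral_dominated_convergence[where w="\<lambda>x. \<bar>indicator (cbox a b) x *\<^sub>R v x\<bar>"])
      show "integrable lebesgue (\<lambda>x. \<bar>indicator (cbox a b) x *\<^sub>R v x\<bar>)"
        using int by (rule integrable_abs)
      have "box_bump a b k \<in> borel_measurable lebesgue" for k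
        by (rule smooth_on_borel_measurable_lebesgue[OF smooth_on_box_bump])
      then show "(\<lambda>x. box_bump a b k x * (indicator (cbox a b) x *\<^sub>R v x)) \<in> borel_measurable lebesgue" for k
        using borel_measurable_integrable[OF int] by (rule borel_measurable_times)
      show "(\<lambda>x. indicator (box a b) x * (indicator (cbox a b) x *\<^sub>R v x)) \<in> borel_measurable lebesgue"
        using borel_measurable_integrable[OF int] by (intro borel_measurable_times borel_measurable_indicator) auto
      show "AE x in lebesgue. (\<lambda>k. box_bump a b k x * (indicator (cbox a b) x *\<^sub>R v x)) \<longlonglongrightarrow>
          indicator (box a b) x * (indicator (cbox a b) x *\<^sub>R v x)"
        by (intro AE_I2 tendsto_mult box_bump_tendsto_indicator tendsto_const)
      show "AE x in lebesgue. norm (box_bump a b k x * (indicator (cbox a b) x *\<^sub>R v x))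
          \<le> \<bar>indicator (cbox a b) x *\<^sub>R v x\<bar>" for k
        using box_bump_bounds[of a b k] by (auto simp: abs_mult intro!: mult_left_le_one_le)
    qed
    moreover have "(LINT x|lebesgue. box_bump a b k x * (indicator (cbox a b) x *\<^sub>R v x)) = 0" for k
    proof -
      have "box_bump a b k x * (indicator (cbox a b) x *\<^sub>R v x) = v x * box_bump a b k x" for x
        using box_bump_eq_0_iff[of a b k x] box_subset_cbox[of a b] by (auto simp: indicator_def)
      moreover have "v x * box_bump a b k x = 0" if "x \<notin> \<Omega>" for x
        using that ab box_bump_eq_0_iff[of a b k x] box_subset_cbox[of a b] by auto
      then have "(LINT x|lebesgue_on \<Omega>. v x * box_bump a b k x) = (LINT x|lebesgue. v x * box_bump a b k x)"
        by (rule integral_lebesgue_on_open[OF assms(1)])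
      ultimately show ?thesis
        using zero[OF box_bump_test_function[OF ab]] by (simp only:)
    qed
    moreover have "indicator (box a b) x * (indicator (cbox a b) x *\<^sub>R v x) = indicator (box a b) x *\<^sub>R v x" for x
      using box_subset_cbox[of a b] by (auto simp: indicator_def)
    ultimately show ?thesis
      by (simp only: set_lebesgue_integral_def LIMSEQ_const_iff)
  qed
  have AEbox: "AE x in lebesgue. x \<in> box c d \<longrightarrow> v x = 0" if cd: "cbox c d \<subseteq> \<Omega>" for c d
  proof -
    have "AE x in lebesgue. indicator (box c d) x *\<^sub>R v x = 0"
    proof (rule AE_eq_0_if_box_integrals_0[where c=c and d=d])
      have "set_integrable lebesgue (cbox c d) v"
        using v cd unfolding locally_integrable_on_def by auto
      then have "set_integrable lebesgue (box c d) v"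
        by (rule set_integrable_subset) (auto simp: box_subset_cbox)
      then show "integrable lebesgue (\<lambda>x. indicator (box c d) x *\<^sub>R v x)"
        by (simp add: set_integrable_def)
      show "(LINT x:box a b|lebesgue. indicator (box c d) x *\<^sub>R v x) = 0" for a b
      proof -
        obtain a' b' where eq: "box a b \<inter> box c d = box a' b'"
          using box_Int_box by blast
        show ?thesis
        proof (cases "box a' b' = {}")
          case True
          then have "indicat_real (box a b) x *\<^sub>R (indicator (box c d) x *\<^sub>R v x) = 0" for x
            using eq by (auto simp: indicator_def)
          then show ?thesis by (simp only: set_lebesgue_integral_def integral_zero)
        next
          case False
          then have "cbox a' b' = closure (box a' b')" by (simp add: closure_box)
          also have "\<dots> \<subseteq> cbox c d" using eq box_subset_cbox[of c d] by (intro closure_minimal) auto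
          finally have "(LINT x:box a' b'|lebesgue. v x) = 0" using cd by (intro box0) auto
          moreover have "indicat_real (box a b) x *\<^sub>R (indicator (box c d) x *\<^sub>R v x) = indicator (box a' b') x *\<^sub>R v x" for x
            using eq by (auto simp: indicator_def)
          ultimately show ?thesis by (simp only: set_lebesgue_integral_def)
        qed
      qed
    qed (auto simp: indicator_def)
    then show ?thesis by eventually_elim (auto simp: indicator_def)
  qed
  obtain \<D> where D: "countable \<D>" "\<And>X. X \<in> \<D> \<Longrightarrow> \<exists>a b. X = box a b \<and> cbox a b \<subseteq> \<Omega>" "\<Omega> \<subseteq> \<Union>\<D>"
  proof -
    let ?F = "{box a b |a b. cbox a b \<subseteq> \<Omega>}"
    have "\<Omega> \<subseteq> \<Union>?F"
    proof
      fix x assume "x \<in> \<Omega>"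
      then obtain a b where "x \<in> box a b" "cbox a b \<subseteq> \<Omega>"
        using open_contains_cbox[of \<Omega>] assms(1) by metis
      then show "x \<in> \<Union>?F" by blast
    qed
    obtain F' where "F' \<subseteq> ?F" "countable F'" "\<Union>F' = \<Union>?F" 
      by (rule Lindelof[of ?F]) auto
    with \<open>\<Omega> \<subseteq> \<Union>?F\<close> show thesis by (intro that[of F']) auto
  qed
  have "AE x in lebesgue. \<forall>X\<in>\<D>. x \<in> X \<longrightarrow> v x = 0"
    using D AEbox by (subst AE_ball_countable) fastforce+
  then have "AE x in lebesgue. x \<in> \<Omega> \<longrightarrow> v x = 0"
    by eventually_elim (use D(3) in auto)
  then show ?thesis using assms(1) by (subst AE_restrict_space_iff) auto
qed

section \<open>Sobolev functions on a bounded open set\<close>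

text \<open>By completeness of Lebesgue measure; it is needed because a representative picked by
  \<^const>\<open>weak_gradient\<close>, and \<open>f \<circ> u\<close> where \<open>u\<close> is not positive, are only known up to null sets.\<close>

lemma borel_measurable_lebesgue_AE_cong:
  fixes f g :: "'a::euclidean_space \<Rightarrow> real"
  assumes f: "f \<in> borel_measurable lebesgue" and eq: "AE x in lebesgue. f x = g x"
  shows "g \<in> borel_measurable lebesgue"
proof (rule measurableI)
  fix A :: "real set" assume "A \<in> sets borel"
  then have A: "f -` A \<inter> space lebesgue \<in> sets lebesgue" by (rule measurable_sets[OF f])
  show "g -` A \<inter> space lebesgue \<in> sets lebesgue"
  proof (rule completion.in_sets_AE[OF _ A])
    show "AE x in lebesgue. (x \<in> f -` A \<inter> space lebesgue) = (x \<in> g -` A \<inter> space lebesgue)"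
      using eq by eventually_elim auto
  qed auto
qed auto

locale bounded_open =
  fixes \<Omega> :: "(real^'n) set"
  assumes open_domain: "open \<Omega>" and bounded_domain: "bounded \<Omega>"
begin

abbreviation "M \<equiv> lebesgue_on \<Omega>"

sublocale M: finite_measure M
  by (rule finite_measure_lebesgue_on)
    (simp add: bounded_set_imp_lmeasurable bounded_domain open_domain)

lemma domain_sets: "\<Omega> \<inter> space lebesgue \<in> sets lebesgue"
  using open_domain by simp

lemma borel_measurable_AE_cong:
  fixes f g :: "real^'n \<Rightarrow> real"
  assumes "f \<in> borel_measurable M" and "AE x in M. f x = g x"
  shows "g \<in> borel_measurable M"
proof -
  have "AE x in lebesgue. x \<in> \<Omega> \<longrightarrow> f x = g x"
    using assms(2) by (subst (asm) AE_restrict_space_iff[OF domain_sets])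
  then have "AE x in lebesgue. indicator \<Omega> x *\<^sub>R f x = indicator \<Omega> x *\<^sub>R g x"
    by eventually_elim (auto simp: indicator_def)
  with assms(1) show ?thesis
    unfolding borel_measurable_restrict_space_iff[OF domain_sets]
    by (rule borel_measurable_lebesgue_AE_cong)
qed

lemma integral_AE_cong:
  fixes k l :: "real^'n \<Rightarrow> real"
  assumes "k \<in> borel_measurable M" "AE x in M. k x = l x"
  shows "(LINT x|M. k x) = (LINT x|M. l x)"
  by (rule integral_cong_AE[OF assms(1) borel_measurable_AE_cong[OF assms] assms(2)])

lemma smooth_on_borel_measurable:
  "smooth_on f UNIV \<Longrightarrow> f \<in> borel_measurable M" for f :: "real^'n \<Rightarrow> real"
  by (rule measurable_restrict_space1[OF smooth_on_borel_measurable_lebesgue])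

subsection \<open>Square integrable functions\<close>

lemma L2I: "u \<in> borel_measurable M \<Longrightarrow> integrable M (\<lambda>x. (u x)\<^sup>2) \<Longrightarrow> u \<in> L2 \<Omega>"
  by (simp add: L2_def)

lemma L2D:
  assumes "u \<in> L2 \<Omega>"
  shows "u \<in> borel_measurable M" "integrable M (\<lambda>x. (u x)\<^sup>2)"
  using assms by (simp_all add: L2_def)

lemma L2_diff:
  assumes "u \<in> L2 \<Omega>" "v \<in> L2 \<Omega>"
  shows "(\<lambda>x. u x - v x) \<in> L2 \<Omega>"
proof (rule L2I)
  note [measurable] = L2D(1)[OF assms(1)] L2D(1)[OF assms(2)]
  show "(\<lambda>x. u x - v x) \<in> borel_measurable M" by measurable
  show "integrable M (\<lambda>x. (u x - v x)\<^sup>2)"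
  proof (rule Bochner_Integration.integrable_bound)
    show "integrable M (\<lambda>x. 2 * (u x)\<^sup>2 + 2 * (v x)\<^sup>2)"
      using L2D(2)[OF assms(1)] L2D(2)[OF assms(2)] by simp
    have "(s - t)\<^sup>2 \<le> 2 * s\<^sup>2 + 2 * t\<^sup>2" for s t :: real
      using zero_le_power2[of "s + t"] by (simp add: power2_eq_square algebra_simps)
    then show "AE x in M. norm ((u x - v x)\<^sup>2) \<le> norm (2 * (u x)\<^sup>2 + 2 * (v x)\<^sup>2)" by simp
  qed measurable
qed

lemma L2_mult_integrable:
  assumes "u \<in> L2 \<Omega>" "v \<in> L2 \<Omega>"
  shows "integrable M (\<lambda>x. u x * v x)"
proof (rule Bochner_Integration.integrable_bound)
  note [measurable] = L2D(1)[OF assms(1)] L2D(1)[OF assms(2)]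
  show "integrable M (\<lambda>x. (u x)\<^sup>2 + (v x)\<^sup>2)"
    using L2D(2)[OF assms(1)] L2D(2)[OF assms(2)] by simp
  have "\<bar>s * t\<bar> \<le> s\<^sup>2 + t\<^sup>2" for s t :: real
  proof -
    have "2 * \<bar>s * t\<bar> \<le> s\<^sup>2 + t\<^sup>2"
      using sum_squares_bound[of "\<bar>s\<bar>" "\<bar>t\<bar>"] by (simp add: abs_mult mult.assoc)
    then show ?thesis by (smt (verit) abs_ge_zero)
  qed
  then show "AE x in M. norm (u x * v x) \<le> norm ((u x)\<^sup>2 + (v x)\<^sup>2)" by simp
  show "(\<lambda>x. u x * v x) \<in> borel_measurable M" by measurable
qed

lemma L2_bounded:
  assumes [measurable]: "b \<in> borel_measurable M" and "AE x in M. \<bar>b x\<bar> \<le> B"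
  shows "b \<in> L2 \<Omega>"
proof (rule L2I)
  show "integrable M (\<lambda>x. (b x)\<^sup>2)"
  proof (rule M.integrable_const_bound[where B="B\<^sup>2"])
    show "AE x in M. norm ((b x)\<^sup>2) \<le> B\<^sup>2"
      using assms(2) by eventually_elim (simp add: abs_le_square_iff[symmetric])
  qed measurable
qed measurable

lemma L2_bounded_mult:
  assumes [measurable]: "b \<in> borel_measurable M" and B: "AE x in M. \<bar>b x\<bar> \<le> B" and u: "u \<in> L2 \<Omega>"
  shows "(\<lambda>x. b x * u x) \<in> L2 \<Omega>"
proof (rule L2I)
  note [measurable] = L2D(1)[OF u]
  show "(\<lambda>x. b x * u x) \<in> borel_measurable M" by measurable
  show "integrable M (\<lambda>x. (b x * u x)\<^sup>2)"
  proof (rule Bochner_Integration.integrable_bound)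
    show "integrable M (\<lambda>x. B\<^sup>2 * (u x)\<^sup>2)" using L2D(2)[OF u] by simp
    show "AE x in M. norm ((b x * u x)\<^sup>2) \<le> norm (B\<^sup>2 * (u x)\<^sup>2)"
      using B by eventually_elim
        (auto simp: power_mult_distrib abs_le_square_iff[symmetric] intro!: mult_right_mono)
  qed measurable
qed

lemma L2_AE_cong:
  assumes u: "u \<in> L2 \<Omega>" and eq: "AE x in M. u x = v x"
  shows "v \<in> L2 \<Omega>"
proof (rule L2I)
  show v: "v \<in> borel_measurable M" by (rule borel_measurable_AE_cong[OF L2D(1)[OF u] eq])
  show "integrable M (\<lambda>x. (v x)\<^sup>2)"
  proof (rule integrable_cong_AE_imp[OF L2D(2)[OF u]])
    show "(\<lambda>x. (v x)\<^sup>2) \<in> borel_measurable M" using v by (rule borel_measurable_power)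
    show "AE x in M. (u x)\<^sup>2 = (v x)\<^sup>2" using eq by eventually_elim simp
  qed
qed

text \<open>Weak convergence from strong convergence. Instead of the Cauchy-Schwarz inequality the proof uses
  \<open>\<bar>d b\<bar> \<le> d\<^sup>2 / t + t b\<^sup>2\<close> with the weight \<open>t\<close> tending to zero as slowly as the norm of \<open>d\<close>.\<close>

lemma L2_tendsto_integral_mult:
  assumes d: "\<And>k. d k \<in> L2 \<Omega>" and b: "b \<in> L2 \<Omega>"
    and lim: "(\<lambda>k. LINT x|M. (d k x)\<^sup>2) \<longlonglongrightarrow> 0"
  shows "(\<lambda>k. LINT x|M. d k x * b x) \<longlonglongrightarrow> 0"
proof -
  define D where "D k = (LINT x|M. (d k x)\<^sup>2)" for k
  define E where "E = (LINT x|M. (b x)\<^sup>2)"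
  \<comment> \<open>the second summand only keeps the weight positive when \<open>D k = 0\<close>\<close>
  define t where "t k = sqrt (D k) + inverse (real (Suc k))" for k
  have D0: "D k \<ge> 0" for k unfolding D_def by simp
  have t0: "t k > 0" for k using D0[of k] unfolding t_def by (intro add_nonneg_pos) auto
  have bound: "\<bar>LINT x|M. d k x * b x\<bar> \<le> sqrt (D k) + t k * E" for k
  proof -
    have "\<bar>LINT x|M. d k x * b x\<bar> \<le> (LINT x|M. \<bar>d k x * b x\<bar>)" by (rule integral_abs_bound)
    also have "\<dots> \<le> (LINT x|M. (d k x)\<^sup>2 / t k + t k * (b x)\<^sup>2)"
    proof (rule integral_mono)
      show "integrable M (\<lambda>x. \<bar>d k x * b x\<bar>)" using L2_mult_integrable[OF d b] by simp
      show "integrable M (\<lambda>x. (d k x)\<^sup>2 / t k + t k * (b x)\<^sup>2)"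
        using L2D(2)[OF d] L2D(2)[OF b] by simp
      show "\<bar>d k x * b x\<bar> \<le> (d k x)\<^sup>2 / t k + t k * (b x)\<^sup>2" for x
      proof -
        have "t k * \<bar>d k x * b x\<bar> \<le> (d k x)\<^sup>2 + (t k * b x)\<^sup>2"
        proof -
          have "2 * (\<bar>d k x\<bar> * \<bar>t k * b x\<bar>) \<le> (d k x)\<^sup>2 + (t k * b x)\<^sup>2"
            using sum_squares_bound[of "\<bar>d k x\<bar>" "\<bar>t k * b x\<bar>"] by (simp add: mult.assoc)
          moreover have "t k * \<bar>d k x * b x\<bar> = \<bar>d k x\<bar> * \<bar>t k * b x\<bar>"
            using t0[of k] by (simp add: abs_mult)
          moreover have "0 \<le> \<bar>d k x\<bar> * \<bar>t k * b x\<bar>" by simp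
          ultimately show ?thesis by linarith
        qed
        then show ?thesis using t0[of k] by (simp add: field_simps power2_eq_square)
      qed
    qed
    also have "\<dots> = D k / t k + t k * E"
      using L2D(2)[OF d] L2D(2)[OF b] by (simp add: D_def E_def)
    also have "D k / t k \<le> sqrt (D k)"
    proof -
      have "D k = sqrt (D k) * sqrt (D k)" using D0 by simp
      also have "\<dots> \<le> sqrt (D k) * t k" using D0[of k] by (intro mult_left_mono) (auto simp: t_def)
      finally show ?thesis using t0[of k] by (simp add: divide_le_eq)
    qed
    finally show ?thesis by simp
  qed
  have "D \<longlonglongrightarrow> 0" using lim unfolding D_def .
  then have sq: "(\<lambda>k. sqrt (D k)) \<longlonglongrightarrow> 0" using tendsto_real_sqrt by fastforce
  moreover have "t \<longlonglongrightarrow> 0 + 0" unfolding t_def by (intro tendsto_add sq LIMSEQ_inverse_real_of_nat)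
  ultimately have "(\<lambda>k. sqrt (D k) + t k * E) \<longlonglongrightarrow> 0 + (0 + 0) * E"
    by (intro tendsto_add tendsto_mult tendsto_const)
  then have lim0: "(\<lambda>k. sqrt (D k) + t k * E) \<longlonglongrightarrow> 0" by simp
  show ?thesis
    by (rule Lim_null_comparison[OF _ lim0]) (use bound in simp)
qed

lemma smooth_bounded_L2:
  fixes \<phi> :: "real^'n \<Rightarrow> real"
  assumes "smooth_on \<phi> UNIV" "\<And>x. \<bar>\<phi> x\<bar> \<le> B"
  shows "\<phi> \<in> L2 \<Omega>"
  by (rule L2_bounded[OF smooth_on_borel_measurable]) (use assms in auto)

lemma test_function_L2:
  assumes "\<phi> \<in> test_functions \<Omega>"
  shows "\<phi> \<in> L2 \<Omega>" "(\<lambda>x. grad \<phi> x $ i) \<in> L2 \<Omega>"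
proof -
  note s = test_function_smooth[OF assms]
  obtain B where B: "\<And>x. \<bar>\<phi> x\<bar> \<le> B" "\<And>x. \<bar>grad \<phi> x $ i\<bar> \<le> B"
    using test_function_grad_bound[OF assms] by metis
  show "\<phi> \<in> L2 \<Omega>" by (rule smooth_bounded_L2[OF s B(1)])
  show "(\<lambda>x. grad \<phi> x $ i) \<in> L2 \<Omega>" by (rule smooth_bounded_L2[OF smooth_on_grad_nth[OF s] B(2)])
qed

subsection \<open>Weak gradients\<close>

lemma L2_locally_integrable:
  assumes "u \<in> L2 \<Omega>"
  shows "u locally_integrable_on \<Omega>"
proof -
  have "(\<lambda>x. 1) \<in> L2 \<Omega>" by (rule L2_bounded[where B=1]) auto
  then have "integrable M u" using L2_mult_integrable[OF assms] by force
  then have "set_integrable lebesgue \<Omega> u"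
    by (simp add: set_integrable_def integrable_restrict_space[OF domain_sets])
  then have "set_integrable lebesgue K u" if "compact K" "K \<subseteq> \<Omega>" for K
    by (rule set_integrable_subset) (use that in \<open>auto simp: compact_imp_closed\<close>)
  then show ?thesis unfolding locally_integrable_on_def by blast
qed

lemma locally_integrable_mult_test_function:
  assumes v: "v locally_integrable_on \<Omega>" and \<phi>: "\<phi> \<in> test_functions \<Omega>"
  shows "integrable M (\<lambda>x. v x * \<phi> x)"
proof -
  obtain K where K: "compact K" "K \<subseteq> \<Omega>" "\<And>x. x \<notin> K \<Longrightarrow> \<phi> x = 0"
    using test_function_support[OF \<phi>] by metis
  obtain B where B: "\<And>x. \<bar>\<phi> x\<bar> \<le> B" using test_function_grad_bound[OF \<phi>] by metis
  have K': "integrable lebesgue (\<lambda>x. indicator K x *\<^sub>R v x)"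
    using v K unfolding locally_integrable_on_def set_integrable_def by auto
  have "integrable lebesgue (\<lambda>x. (indicator K x *\<^sub>R v x) * \<phi> x)"
  proof (rule Bochner_Integration.integrable_bound)
    show "integrable lebesgue (\<lambda>x. B * (indicator K x *\<^sub>R v x))"
      using K' by (intro integrable_mult_right)
    show "(\<lambda>x. (indicator K x *\<^sub>R v x) * \<phi> x) \<in> borel_measurable lebesgue"
      by (rule borel_measurable_times[OF borel_measurable_integrable[OF K']
            smooth_on_borel_measurable_lebesgue[OF test_function_smooth[OF \<phi>]]])
    have "B \<ge> 0" using B[of 0] by linarith
    then have "\<bar>indicator K x *\<^sub>R v x\<bar> * \<bar>\<phi> x\<bar> \<le> \<bar>B\<bar> * \<bar>indicator K x *\<^sub>R v x\<bar>" for x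
      using mult_left_mono[OF B[of x], of "\<bar>indicator K x *\<^sub>R v x\<bar>"] by (simp add: mult.commute)
    then show "AE x in lebesgue. norm ((indicator K x *\<^sub>R v x) * \<phi> x) \<le> norm (B * (indicator K x *\<^sub>R v x))"
      by (intro AE_I2) (simp only: real_norm_def abs_mult)
  qed
  moreover have "(indicator K x *\<^sub>R v x) * \<phi> x = indicator \<Omega> x *\<^sub>R (v x * \<phi> x)" for x
    using K(2) K(3)[of x] by (auto simp: indicator_def)
  ultimately show ?thesis by (simp only: integrable_restrict_space[OF domain_sets])
qed

lemma has_weak_gradientD:
  assumes "has_weak_gradient \<Omega> u g" "\<eta> \<in> test_functions \<Omega>"
  shows "(LINT x|M. u x * grad \<eta> x $ i) = - (LINT x|M. g x $ i * \<eta> x)"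
proof -
  have "\<forall>\<phi>\<in>test_functions \<Omega>. (LINT x|M. u x * grad \<phi> x $ i) = - (LINT x|M. g x $ i * \<phi> x)"
    using assms(1) unfolding has_weak_gradient_def grad_nth by simp
  with assms(2) show ?thesis by (rule bspec[rotated])
qed

text \<open>The Hilbert choice in \<^const>\<open>weak_gradient\<close> selects some weak gradient; uniqueness
  identifies it with any explicitly computed one.\<close>

lemma has_weak_gradient_unique:
  assumes "has_weak_gradient \<Omega> u g" "has_weak_gradient \<Omega> u g'"
  shows "AE x in M. g x = g' x"
proof -
  have "AE x in M. g x $ i = g' x $ i" for i
  proof -
    have l: "(\<lambda>x. g x $ i) locally_integrable_on \<Omega>" "(\<lambda>x. g' x $ i) locally_integrable_on \<Omega>"
      using assms by (auto simp: has_weak_gradient_def)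
    have "AE x in M. g x $ i - g' x $ i = 0"
    proof (rule AE_eq_0_if_test_integrals_0[OF open_domain])
      show "(\<lambda>x. g x $ i - g' x $ i) locally_integrable_on \<Omega>"
        using l unfolding locally_integrable_on_def by (auto intro: set_integral_diff)
      fix \<phi> assume \<phi>: "\<phi> \<in> test_functions \<Omega>"
      have "(LINT x|M. g x $ i * \<phi> x) = (LINT x|M. g' x $ i * \<phi> x)"
        using has_weak_gradientD[OF assms(1) \<phi>, of i] has_weak_gradientD[OF assms(2) \<phi>, of i]
        by simp
      then show "(LINT x|M. (g x $ i - g' x $ i) * \<phi> x) = 0"
        using l[THEN locally_integrable_mult_test_function, OF \<phi>] by (simp add: left_diff_distrib)
    qed
    then show ?thesis by eventually_elim simp
  qed
  then have "AE x in M. \<forall>i. g x $ i = g' x $ i" by (subst AE_all_countable) blast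
  then show ?thesis by eventually_elim (simp add: vec_eq_iff)
qed

lemma has_weak_gradient_weak_gradient:
  "has_weak_gradient \<Omega> u g \<Longrightarrow> has_weak_gradient \<Omega> u (weak_gradient \<Omega> u)"
  unfolding weak_gradient_def by (rule someI[of "has_weak_gradient \<Omega> u"])

lemma weak_gradient_eq:
  "has_weak_gradient \<Omega> u g \<Longrightarrow> AE x in M. weak_gradient \<Omega> u x = g x"
  by (rule has_weak_gradient_unique[OF has_weak_gradient_weak_gradient])

lemma has_weak_gradientI:
  assumes "u \<in> L2 \<Omega>" "\<And>i. (\<lambda>x. g x $ i) \<in> L2 \<Omega>"
    and "\<And>\<eta> i. \<eta> \<in> test_functions \<Omega> \<Longrightarrow>
      (LINT x|M. u x * grad \<eta> x $ i) = - (LINT x|M. g x $ i * \<eta> x)"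
  shows "has_weak_gradient \<Omega> u g"
  using assms(3) L2_locally_integrable[OF assms(1)] L2_locally_integrable[OF assms(2)]
  unfolding has_weak_gradient_def grad_nth by simp

lemma test_function_has_weak_gradient:
  assumes \<phi>: "\<phi> \<in> test_functions \<Omega>"
  shows "has_weak_gradient \<Omega> \<phi> (grad \<phi>)"
proof (rule has_weak_gradientI)
  fix \<eta> i assume \<eta>: "\<eta> \<in> test_functions \<Omega>"
  have "(LINT x|M. grad (\<lambda>x. \<phi> x * \<eta> x) x $ i) = 0"
    by (rule integral_grad_test_function[OF open_domain test_function_mult[OF \<eta> test_function_smooth[OF \<phi>]]])
  then have "(LINT x|M. \<phi> x * grad \<eta> x $ i + grad \<phi> x $ i * \<eta> x) = 0"
    by (simp only: grad_mult[OF test_function_smooth[OF \<phi>] test_function_smooth[OF \<eta>]])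
  then show "(LINT x|M. \<phi> x * grad \<eta> x $ i) = - (LINT x|M. grad \<phi> x $ i * \<eta> x)"
    using L2_mult_integrable[OF test_function_L2(1)[OF \<phi>] test_function_L2(2)[OF \<eta>, of i]]
      L2_mult_integrable[OF test_function_L2(2)[OF \<phi>, of i] test_function_L2(1)[OF \<eta>]]
    by simp
qed (rule test_function_L2[OF \<phi>])+

lemma has_weak_gradient_diff:
  assumes u: "has_weak_gradient \<Omega> u g" "u \<in> L2 \<Omega>" "\<And>i. (\<lambda>x. g x $ i) \<in> L2 \<Omega>"
    and v: "has_weak_gradient \<Omega> v h" "v \<in> L2 \<Omega>" "\<And>i. (\<lambda>x. h x $ i) \<in> L2 \<Omega>"
  shows "has_weak_gradient \<Omega> (\<lambda>x. u x - v x) (\<lambda>x. g x - h x)"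
proof (rule has_weak_gradientI)
  show "(\<lambda>x. u x - v x) \<in> L2 \<Omega>" by (rule L2_diff[OF u(2) v(2)])
  show "(\<lambda>x. (g x - h x) $ i) \<in> L2 \<Omega>" for i using L2_diff[OF u(3) v(3)] by simp
  fix \<eta> i assume \<eta>: "\<eta> \<in> test_functions \<Omega>"
  note \<eta>2 = test_function_L2[OF \<eta>]
  show "(LINT x|M. (u x - v x) * grad \<eta> x $ i) = - (LINT x|M. (g x - h x) $ i * \<eta> x)"
    using has_weak_gradientD[OF u(1) \<eta>, of i] has_weak_gradientD[OF v(1) \<eta>, of i]
      L2_mult_integrable[OF u(2) \<eta>2(2)] L2_mult_integrable[OF v(2) \<eta>2(2)]
      L2_mult_integrable[OF u(3) \<eta>2(1)] L2_mult_integrable[OF v(3) \<eta>2(1)]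
    by (simp add: left_diff_distrib)
qed

lemma H1D:
  assumes "u \<in> H1 \<Omega>"
  shows "u \<in> L2 \<Omega>" "has_weak_gradient \<Omega> u (weak_gradient \<Omega> u)"
    "(\<lambda>x. weak_gradient \<Omega> u x $ i) \<in> L2 \<Omega>"
proof -
  obtain g where g: "has_weak_gradient \<Omega> u g" "\<And>i. (\<lambda>x. g x $ i) \<in> L2 \<Omega>"
    using assms by (auto simp: H1_def)
  show "u \<in> L2 \<Omega>" using assms by (simp add: H1_def)
  show "has_weak_gradient \<Omega> u (weak_gradient \<Omega> u)" by (rule has_weak_gradient_weak_gradient[OF g(1)])
  have "AE x in M. g x $ i = weak_gradient \<Omega> u x $ i"
    using weak_gradient_eq[OF g(1)] by eventually_elim simp
  then show "(\<lambda>x. weak_gradient \<Omega> u x $ i) \<in> L2 \<Omega>" by (rule L2_AE_cong[OF g(2)])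
qed

lemma norm_vec_power2: "(norm (w :: real^'n))\<^sup>2 = (\<Sum>i\<in>UNIV. (w $ i)\<^sup>2)"
  by (simp add: norm_vec_def L2_set_def sum_nonneg)

text \<open>Any square integrable weak gradient computes the norm; componentwise square integrals avoid
  measurability questions about vector valued functions.\<close>

lemma H1_norm_eq:
  assumes "has_weak_gradient \<Omega> u g" "\<And>i. (\<lambda>x. g x $ i) \<in> L2 \<Omega>"
  shows "H1_norm \<Omega> u = sqrt ((LINT x|M. (u x)\<^sup>2) + (\<Sum>i\<in>UNIV. LINT x|M. (g x $ i)\<^sup>2))"
proof -
  note eq = weak_gradient_eq[OF assms(1)]
  have gs: "(\<lambda>x. (norm (g x))\<^sup>2) = (\<lambda>x. \<Sum>i\<in>UNIV. (g x $ i)\<^sup>2)" by (simp add: norm_vec_power2)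
  have g: "(\<lambda>x. (norm (g x))\<^sup>2) \<in> borel_measurable M"
    unfolding gs using L2D(1)[OF assms(2)] by (intro borel_measurable_sum borel_measurable_power)
  have eq': "AE x in M. (norm (g x))\<^sup>2 = (norm (weak_gradient \<Omega> u x))\<^sup>2"
    using eq by eventually_elim simp
  have "(LINT x|M. (norm (weak_gradient \<Omega> u x))\<^sup>2) = (LINT x|M. (norm (g x))\<^sup>2)"
    by (rule integral_AE_cong[OF g eq', symmetric])
  also have "\<dots> = (\<Sum>i\<in>UNIV. LINT x|M. (g x $ i)\<^sup>2)"
    unfolding gs by (rule Bochner_Integration.integral_sum) (rule L2D(2)[OF assms(2)])
  finally show ?thesis by (simp add: H1_norm_def)
qed

text \<open>The next two lemmas translate between the definition of \<^const>\<open>H10\<close> by the norm and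
  convergence of the functions and of each partial derivative in \<open>L\<^sup>2\<close>.\<close>

lemma H10_approx:
  assumes "u \<in> H10 \<Omega>"
  obtains \<phi> where "\<And>k::nat. \<phi> k \<in> test_functions \<Omega>"
    "(\<lambda>k. LINT x|M. (u x - \<phi> k x)\<^sup>2) \<longlonglongrightarrow> 0"
    "\<And>i. (\<lambda>k. LINT x|M. (weak_gradient \<Omega> u x $ i - grad (\<phi> k) x $ i)\<^sup>2) \<longlonglongrightarrow> 0"
proof -
  obtain \<phi> where \<phi>: "\<And>k::nat. \<phi> k \<in> test_functions \<Omega>"
    and lim: "(\<lambda>k. H1_norm \<Omega> (\<lambda>x. u x - \<phi> k x)) \<longlonglongrightarrow> 0"
    using assms by (auto simp: H10_def)
  have u: "u \<in> H1 \<Omega>" using assms by (simp add: H10_def)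
  let ?w = "weak_gradient \<Omega> u"
  define A where "A k = (LINT x|M. (u x - \<phi> k x)\<^sup>2)" for k
  define B where "B k i = (LINT x|M. (?w x $ i - grad (\<phi> k) x $ i)\<^sup>2)" for k i
  have A0: "A k \<ge> 0" and B0: "B k i \<ge> 0" for k i by (simp_all add: A_def B_def)
  have "H1_norm \<Omega> (\<lambda>x. u x - \<phi> k x) = sqrt (A k + (\<Sum>i\<in>UNIV. B k i))" for k
  proof -
    have "has_weak_gradient \<Omega> (\<lambda>x. u x - \<phi> k x) (\<lambda>x. ?w x - grad (\<phi> k) x)"
      by (intro has_weak_gradient_diff H1D[OF u] test_function_has_weak_gradient[OF \<phi>] test_function_L2[OF \<phi>])
    moreover have "(\<lambda>x. (?w x - grad (\<phi> k) x) $ i) \<in> L2 \<Omega>" for i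
      using L2_diff[OF H1D(3)[OF u] test_function_L2(2)[OF \<phi>]] by simp
    ultimately show ?thesis by (subst H1_norm_eq) (auto simp: A_def B_def)
  qed
  then have "(\<lambda>k. (sqrt (A k + (\<Sum>i\<in>UNIV. B k i)))\<^sup>2) \<longlonglongrightarrow> 0\<^sup>2"
    using lim by (intro tendsto_power) simp
  then have S: "(\<lambda>k. A k + (\<Sum>i\<in>UNIV. B k i)) \<longlonglongrightarrow> 0"
    using A0 B0 by (simp add: sum_nonneg)
  have "A k \<le> A k + (\<Sum>i\<in>UNIV. B k i)" for k using B0 by (simp add: sum_nonneg)
  then have "A \<longlonglongrightarrow> 0"
    using A0 by (intro tendsto_sandwich[OF _ _ tendsto_const S]) (auto simp: always_eventually)
  moreover have "(\<lambda>k. B k i) \<longlonglongrightarrow> 0" for i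
  proof -
    have "B k i \<le> (\<Sum>i\<in>UNIV. B k i)" for k by (rule member_le_sum) (use B0 in auto)
    then have "B k i \<le> A k + (\<Sum>i\<in>UNIV. B k i)" for k using A0[of k] by (simp add: add_increasing)
    then show ?thesis
      using B0 by (intro tendsto_sandwich[OF _ _ tendsto_const S]) (auto simp: always_eventually)
  qed
  ultimately show thesis using \<phi> by (intro that[of \<phi>]) (simp_all add: A_def[abs_def] B_def)
qed

text \<open>Weak gradients pass to limits, so \<open>W\<close> need not be known in advance to be a weak gradient of \<open>v\<close>.\<close>

lemma H10_closure:
  assumes v: "v \<in> L2 \<Omega>" and W: "\<And>i. (\<lambda>x. W x $ i) \<in> L2 \<Omega>"
    and \<phi>: "\<And>k::nat. \<phi> k \<in> test_functions \<Omega>"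
    and limv: "(\<lambda>k. LINT x|M. (v x - \<phi> k x)\<^sup>2) \<longlonglongrightarrow> 0"
    and limW: "\<And>i. (\<lambda>k. LINT x|M. (W x $ i - grad (\<phi> k) x $ i)\<^sup>2) \<longlonglongrightarrow> 0"
  shows "has_weak_gradient \<Omega> v W" "v \<in> H10 \<Omega>"
proof -
  note \<phi>2 = test_function_L2[OF \<phi>]
  show wg: "has_weak_gradient \<Omega> v W"
  proof (rule has_weak_gradientI[OF v W])
    fix \<eta> i assume \<eta>: "\<eta> \<in> test_functions \<Omega>"
    note \<eta>2 = test_function_L2[OF \<eta>]
    have 1: "(LINT x|M. (v x - \<phi> k x) * grad \<eta> x $ i)
        = (LINT x|M. v x * grad \<eta> x $ i) - (LINT x|M. \<phi> k x * grad \<eta> x $ i)" for k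
      using L2_mult_integrable[OF v \<eta>2(2)] L2_mult_integrable[OF \<phi>2(1) \<eta>2(2)]
      by (simp add: left_diff_distrib)
    have 2: "(LINT x|M. (W x $ i - grad (\<phi> k) x $ i) * \<eta> x)
        = (LINT x|M. W x $ i * \<eta> x) - (LINT x|M. grad (\<phi> k) x $ i * \<eta> x)" for k
      using L2_mult_integrable[OF W \<eta>2(1)] L2_mult_integrable[OF \<phi>2(2) \<eta>2(1)]
      by (simp add: left_diff_distrib)
    have "(\<lambda>k. LINT x|M. (v x - \<phi> k x) * grad \<eta> x $ i) \<longlonglongrightarrow> 0"
      by (intro L2_tendsto_integral_mult L2_diff v \<phi>2 \<eta>2 limv)
    moreover have "(\<lambda>k. LINT x|M. (W x $ i - grad (\<phi> k) x $ i) * \<eta> x) \<longlonglongrightarrow> 0"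
      by (intro L2_tendsto_integral_mult L2_diff W \<phi>2 \<eta>2 limW)
    ultimately have "(\<lambda>k. (LINT x|M. (v x - \<phi> k x) * grad \<eta> x $ i)
        + (LINT x|M. (W x $ i - grad (\<phi> k) x $ i) * \<eta> x)) \<longlonglongrightarrow> 0 + 0"
      by (rule tendsto_add)
    then have "(\<lambda>k::nat. (LINT x|M. v x * grad \<eta> x $ i) + (LINT x|M. W x $ i * \<eta> x)) \<longlonglongrightarrow> 0"
      unfolding 1 2 has_weak_gradientD[OF test_function_has_weak_gradient[OF \<phi>] \<eta>] by simp
    then show "(LINT x|M. v x * grad \<eta> x $ i) = - (LINT x|M. W x $ i * \<eta> x)"
      by (simp add: LIMSEQ_const_iff)
  qed
  have "H1_norm \<Omega> (\<lambda>x. v x - \<phi> k x) = sqrt ((LINT x|M. (v x - \<phi> k x)\<^sup>2)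
      + (\<Sum>i\<in>UNIV. LINT x|M. (W x $ i - grad (\<phi> k) x $ i)\<^sup>2))" for k
  proof -
    have "has_weak_gradient \<Omega> (\<lambda>x. v x - \<phi> k x) (\<lambda>x. W x - grad (\<phi> k) x)"
      by (intro has_weak_gradient_diff wg v W test_function_has_weak_gradient[OF \<phi>] \<phi>2)
    moreover have "(\<lambda>x. (W x - grad (\<phi> k) x) $ i) \<in> L2 \<Omega>" for i
      using L2_diff[OF W \<phi>2(2)] by simp
    ultimately show ?thesis by (subst H1_norm_eq) auto
  qed
  moreover have "(\<lambda>k. sqrt ((LINT x|M. (v x - \<phi> k x)\<^sup>2)
      + (\<Sum>i\<in>UNIV. LINT x|M. (W x $ i - grad (\<phi> k) x $ i)\<^sup>2))) \<longlonglongrightarrow> sqrt (0 + (\<Sum>i\<in>(UNIV::'n set). 0))"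
    by (intro tendsto_real_sqrt tendsto_add tendsto_sum limv limW)
  ultimately have "(\<lambda>k. H1_norm \<Omega> (\<lambda>x. v x - \<phi> k x)) \<longlonglongrightarrow> 0" by simp
  then show "v \<in> H10 \<Omega>"
    using v wg W \<phi> unfolding H10_def H1_def by blast
qed

text \<open>The chain rule. If \<open>\<phi>\<^sub>k \<rightarrow> u\<close> in \<open>H1\<close>, then
  \<open>p'(u) \<nabla>u - p'(\<phi>\<^sub>k) \<nabla>\<phi>\<^sub>k = (p'(u) - p'(\<phi>\<^sub>k)) \<nabla>u + p'(\<phi>\<^sub>k) (\<nabla>u - \<nabla>\<phi>\<^sub>k)\<close>. The second term is small
  because \<open>p'\<close> is bounded; the first one by dominated convergence, once a subsequence of \<open>\<phi>\<^sub>k\<close>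
  converging almost everywhere is chosen.\<close>

lemma H10_compose:
  assumes u: "u \<in> H10 \<Omega>"
    and p: "smooth_on p UNIV" "p 0 = 0" "\<And>t. (p has_real_derivative p' t) (at t)"
    and p': "continuous_on UNIV p'" "\<And>t. \<bar>p' t\<bar> \<le> B"
  shows "(\<lambda>x. p (u x)) \<in> H10 \<Omega>"
    "AE x in M. weak_gradient \<Omega> (\<lambda>x. p (u x)) x = p' (u x) *\<^sub>R weak_gradient \<Omega> u x"
proof -
  let ?w = "weak_gradient \<Omega> u"
  have uH1: "u \<in> H1 \<Omega>" using u by (simp add: H10_def)
  note uL2 = H1D(1)[OF uH1] and wL2 = H1D(3)[OF uH1]
  have B0: "B \<ge> 0" using p'(2)[of 0] by linarith
  have lip: "\<bar>p s - p t\<bar> \<le> B * \<bar>s - t\<bar>" for s t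
    using field_differentiable_bound[of UNIV p p' B s t] p(3) p'(2) by simp
  have contp: "continuous_on UNIV p" by (rule smooth_on_continuous[OF p(1)])
  have [measurable]: "p \<in> borel_measurable borel" "p' \<in> borel_measurable borel"
    using contp p'(1) by (auto intro: borel_measurable_continuous_onI)
  obtain \<psi> where \<psi>: "\<And>k::nat. \<psi> k \<in> test_functions \<Omega>"
    and lim0: "(\<lambda>k. LINT x|M. (u x - \<psi> k x)\<^sup>2) \<longlonglongrightarrow> 0"
      "\<And>i. (\<lambda>k. LINT x|M. (?w x $ i - grad (\<psi> k) x $ i)\<^sup>2) \<longlonglongrightarrow> 0"
    by (rule H10_approx[OF u]) (rule that)
  have "\<exists>r::nat \<Rightarrow> nat. strict_mono r \<and> (AE x in M. (\<lambda>k. (u x - \<psi> (r k) x)\<^sup>2) \<longlonglongrightarrow> 0)"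
  proof (rule tendsto_L1_AE_subseq)
    show "integrable M (\<lambda>x. (u x - \<psi> k x)\<^sup>2)" for k
      by (rule L2D(2)[OF L2_diff[OF uL2 test_function_L2(1)[OF \<psi>]]])
    show "(\<lambda>k. LINT x|M. norm ((u x - \<psi> k x)\<^sup>2)) \<longlonglongrightarrow> 0" using lim0(1) by simp
  qed
  then obtain r where r: "strict_mono r" and AEr: "AE x in M. (\<lambda>k. (u x - \<psi> (r k) x)\<^sup>2) \<longlonglongrightarrow> 0"
    by blast
  define \<phi> where "\<phi> k = \<psi> (r k)" for k
  have \<phi>: "\<phi> k \<in> test_functions \<Omega>" for k unfolding \<phi>_def by (rule \<psi>)
  note \<phi>2 = test_function_L2[OF \<phi>] and \<phi>s = test_function_smooth[OF \<phi>]
  have lim: "(\<lambda>k. LINT x|M. (u x - \<phi> k x)\<^sup>2) \<longlonglongrightarrow> 0"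
      "(\<lambda>k. LINT x|M. (?w x $ i - grad (\<phi> k) x $ i)\<^sup>2) \<longlonglongrightarrow> 0" for i
    using LIMSEQ_subseq_LIMSEQ[OF lim0(1) r] LIMSEQ_subseq_LIMSEQ[OF lim0(2)[of i] r]
    by (simp_all add: \<phi>_def o_def)
  have AElim: "AE x in M. (\<lambda>k. \<phi> k x) \<longlonglongrightarrow> u x"
    using AEr
  proof eventually_elim
    case (elim x)
    have "(\<lambda>k. u x - \<psi> (r k) x) \<longlonglongrightarrow> 0"
    using tendsto_real_sqrt[OF elim] by (simp add: tendsto_rabs_zero_iff)
    then have "(\<lambda>k. u x - (u x - \<psi> (r k) x)) \<longlonglongrightarrow> u x - 0" by (intro tendsto_diff tendsto_const)
    then show ?case by (simp add: \<phi>_def)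
  qed
  note [measurable] = L2D(1)[OF uL2] L2D(1)[OF wL2] L2D(1)[OF \<phi>2(1)] L2D(1)[OF \<phi>2(2)]
  define v where "v x = p (u x)" for x
  define W where "W x = p' (u x) *\<^sub>R ?w x" for x
  define \<theta> where "\<theta> k x = p (\<phi> k x)" for k x
  have \<theta>: "\<theta> k \<in> test_functions \<Omega>" for k
    unfolding \<theta>_def by (rule test_function_compose[OF \<phi> p(1,2)])
  note \<theta>2 = test_function_L2[OF \<theta>]
  have grad\<theta>: "grad (\<theta> k) x $ i = p' (\<phi> k x) * grad (\<phi> k) x $ i" for k x i
    unfolding \<theta>_def by (rule grad_compose[OF \<phi>s p(3)])
  have v2: "v \<in> L2 \<Omega>"
  proof (rule L2I)
    show "v \<in> borel_measurable M" unfolding v_def by measurable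
    show "integrable M (\<lambda>x. (v x)\<^sup>2)"
    proof (rule Bochner_Integration.integrable_bound)
      show "integrable M (\<lambda>x. B\<^sup>2 * (u x)\<^sup>2)" using L2D(2)[OF uL2] by simp
      have "(p t)\<^sup>2 \<le> B\<^sup>2 * t\<^sup>2" for t
        using power_mono[OF lip[of t 0], of 2] p(2) by (simp add: power_mult_distrib)
      then show "AE x in M. norm ((v x)\<^sup>2) \<le> norm (B\<^sup>2 * (u x)\<^sup>2)" by (simp add: v_def)
      show "(\<lambda>x. (v x)\<^sup>2) \<in> borel_measurable M" unfolding v_def by measurable
    qed
  qed
  have W2: "(\<lambda>x. W x $ i) \<in> L2 \<Omega>" for i
    unfolding W_def vector_scaleR_component real_scaleR_def
    by (rule L2_bounded_mult[OF _ _ wL2, where B=B]) (use p'(2) in auto)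
  have limv: "(\<lambda>k. LINT x|M. (v x - \<theta> k x)\<^sup>2) \<longlonglongrightarrow> 0"
  proof (rule tendsto_sandwich[OF _ _ tendsto_const])
    show "(\<lambda>k. B\<^sup>2 * (LINT x|M. (u x - \<phi> k x)\<^sup>2)) \<longlonglongrightarrow> 0"
      using tendsto_mult_right_zero[OF lim(1)] by simp
    have "(LINT x|M. (v x - \<theta> k x)\<^sup>2) \<le> (LINT x|M. B\<^sup>2 * (u x - \<phi> k x)\<^sup>2)" for k
    proof (rule integral_mono)
      show "integrable M (\<lambda>x. (v x - \<theta> k x)\<^sup>2)" by (rule L2D(2)[OF L2_diff[OF v2 \<theta>2(1)]])
      show "integrable M (\<lambda>x. B\<^sup>2 * (u x - \<phi> k x)\<^sup>2)" using L2D(2)[OF L2_diff[OF uL2 \<phi>2(1)]] by simp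
      show "(v x - \<theta> k x)\<^sup>2 \<le> B\<^sup>2 * (u x - \<phi> k x)\<^sup>2" for x
        using power_mono[OF lip[of "u x" "\<phi> k x"], of 2] by (simp add: v_def \<theta>_def power_mult_distrib)
    qed
    then show "\<forall>\<^sub>F k in sequentially. (LINT x|M. (v x - \<theta> k x)\<^sup>2) \<le> B\<^sup>2 * (LINT x|M. (u x - \<phi> k x)\<^sup>2)"
      by simp
  qed simp
  have limW: "(\<lambda>k. LINT x|M. (W x $ i - grad (\<theta> k) x $ i)\<^sup>2) \<longlonglongrightarrow> 0" for i
  proof (rule tendsto_sandwich[OF _ _ tendsto_const])
    let ?e = "\<lambda>k x. ((p' (u x) - p' (\<phi> k x)) * ?w x $ i)\<^sup>2"
    have e_le: "?e k x \<le> (2 * B)\<^sup>2 * (?w x $ i)\<^sup>2" for k x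
    proof -
      have "\<bar>p' (u x) - p' (\<phi> k x)\<bar> \<le> 2 * B" using p'(2)[of "u x"] p'(2)[of "\<phi> k x"] by linarith
      then have "(p' (u x) - p' (\<phi> k x))\<^sup>2 \<le> (2 * B)\<^sup>2" using B0 by (simp only: power2_le_iff_abs_le)
      then show ?thesis by (simp only: power_mult_distrib mult_right_mono zero_le_power2)
    qed
    have ew: "integrable M (\<lambda>x. (2 * B)\<^sup>2 * (?w x $ i)\<^sup>2)" using L2D(2)[OF wL2] by simp
    have em: "?e k \<in> borel_measurable M" for k by measurable
    have ei: "integrable M (?e k)" for k
      by (rule Bochner_Integration.integrable_bound[OF ew em]) (use e_le in auto)
    have elim: "(\<lambda>k. LINT x|M. ?e k x) \<longlonglongrightarrow> (LINT x|M. 0)"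
    proof (rule integral_dominated_convergence[OF _ em ew])
      show "AE x in M. (\<lambda>k. ?e k x) \<longlonglongrightarrow> 0"
        using AElim
      proof eventually_elim
        case (elim x)
        have "(\<lambda>k. p' (\<phi> k x)) \<longlonglongrightarrow> p' (u x)"
          using p'(1) elim by (intro continuous_on_tendsto_compose[OF p'(1)]) auto
        then have "(\<lambda>k. ?e k x) \<longlonglongrightarrow> ((p' (u x) - p' (u x)) * ?w x $ i)\<^sup>2"
          by (intro tendsto_intros)
        then show ?case by simp
      qed
      show "AE x in M. norm (?e k x) \<le> (2 * B)\<^sup>2 * (?w x $ i)\<^sup>2" for k using e_le by simp
    qed simp
    let ?d = "\<lambda>k x. (?w x $ i - grad (\<phi> k) x $ i)\<^sup>2"
    have di: "integrable M (?d k)" for k by (rule L2D(2)[OF L2_diff[OF wL2 \<phi>2(2)]])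
    have "(\<lambda>k. 2 * (LINT x|M. ?e k x) + 2 * B\<^sup>2 * (LINT x|M. ?d k x)) \<longlonglongrightarrow> 2 * 0 + 2 * B\<^sup>2 * 0"
      by (intro tendsto_add tendsto_mult tendsto_const lim(2)) (use elim in simp)
    then show "(\<lambda>k. 2 * (LINT x|M. ?e k x) + 2 * B\<^sup>2 * (LINT x|M. ?d k x)) \<longlonglongrightarrow> 0" by simp
    have "(LINT x|M. (W x $ i - grad (\<theta> k) x $ i)\<^sup>2)
        \<le> (LINT x|M. 2 * ?e k x + 2 * B\<^sup>2 * ?d k x)" for k
    proof (rule integral_mono)
      show "integrable M (\<lambda>x. (W x $ i - grad (\<theta> k) x $ i)\<^sup>2)" by (rule L2D(2)[OF L2_diff[OF W2 \<theta>2(2)]])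
      show "integrable M (\<lambda>x. 2 * ?e k x + 2 * B\<^sup>2 * ?d k x)" using ei di by simp
      fix x
      have "W x $ i - grad (\<theta> k) x $ i = (p' (u x) - p' (\<phi> k x)) * ?w x $ i
          + p' (\<phi> k x) * (?w x $ i - grad (\<phi> k) x $ i)"
        by (simp add: W_def grad\<theta> algebra_simps)
      moreover have "(s + t)\<^sup>2 \<le> 2 * s\<^sup>2 + 2 * t\<^sup>2" for s t :: real
        using zero_le_power2[of "s - t"] by (simp add: power2_eq_square algebra_simps)
      ultimately have "(W x $ i - grad (\<theta> k) x $ i)\<^sup>2 \<le> 2 * ?e k x
          + 2 * (p' (\<phi> k x) * (?w x $ i - grad (\<phi> k) x $ i))\<^sup>2" by simp
      moreover have "(p' (\<phi> k x) * (?w x $ i - grad (\<phi> k) x $ i))\<^sup>2 \<le> B\<^sup>2 * ?d k x"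
        using p'(2)[of "\<phi> k x"] B0
        by (auto simp: power_mult_distrib abs_le_square_iff[symmetric] intro!: mult_right_mono)
      ultimately show "(W x $ i - grad (\<theta> k) x $ i)\<^sup>2 \<le> 2 * ?e k x + 2 * B\<^sup>2 * ?d k x" by simp
    qed
    then show "\<forall>\<^sub>F k in sequentially. (LINT x|M. (W x $ i - grad (\<theta> k) x $ i)\<^sup>2)
        \<le> 2 * (LINT x|M. ?e k x) + 2 * B\<^sup>2 * (LINT x|M. ?d k x)"
      using ei di by simp
  qed simp
  note closure = H10_closure[OF v2 W2 \<theta> limv limW]
  show "(\<lambda>x. p (u x)) \<in> H10 \<Omega>" using closure(2) by (simp add: v_def[abs_def])
  show "AE x in M. weak_gradient \<Omega> (\<lambda>x. p (u x)) x = p' (u x) *\<^sub>R ?w x"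
    using weak_gradient_eq[OF closure(1)] by (simp add: v_def[abs_def] W_def)
qed

end

section \<open>Convex nonlinearities on the half-line\<close>

text \<open>All derivatives of \<open>f\<close> are one-sided at \<open>0\<close>, so the mean value theorem and monotonicity are
  recorded for derivatives within \<open>[0,\<infinity>)\<close>.\<close>

lemma half_line_mvt:
  fixes F F' :: "real \<Rightarrow> real"
  assumes D: "\<And>t. t \<ge> 0 \<Longrightarrow> (F has_real_derivative F' t) (at t within {0..})"
    and st: "0 \<le> s" "s < t"
  shows "\<exists>z. s < z \<and> z < t \<and> F t - F s = F' z * (t - s)"
proof -
  have "\<exists>z\<in>{s<..<t}. F t - F s = F' z * (t - s)"
  proof (rule mvt_simple[OF st(2)])
    fix x assume "s \<le> x" "x \<le> t"
    then have "(F has_real_derivative F' x) (at x within {s..t})"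
      using st by (intro DERIV_subset[OF D]) auto
    then show "(F has_derivative (*) (F' x)) (at x within {s..t})"
      by (simp add: has_field_derivative_def)
  qed
  then show ?thesis by auto
qed

lemma half_line_mono:
  fixes F F' :: "real \<Rightarrow> real"
  assumes D: "\<And>t. t \<ge> 0 \<Longrightarrow> (F has_real_derivative F' t) (at t within {0..})"
    and st: "0 \<le> s" "s \<le> t" and nonneg: "\<And>r. s < r \<Longrightarrow> r < t \<Longrightarrow> F' r \<ge> 0"
  shows "F s \<le> F t"
proof (cases "s = t")
  case False
  then obtain z where "s < z" "z < t" "F t - F s = F' z * (t - s)"
    using half_line_mvt[OF D] st by force
  then show ?thesis using nonneg[of z] st mult_nonneg_nonneg[of "F' z" "t - s"] by linarith
qed simp

text \<open>Inequalities on \<open>[0,\<infinity>)\<close> up to an additive constant only have to be checked for large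
  arguments.\<close>

lemma half_line_bounded_below:
  fixes E :: "real \<Rightarrow> real"
  assumes "continuous_on {0..} E" and "eventually (\<lambda>t. E t \<ge> 0) at_top"
  shows "\<exists>C. \<forall>t\<ge>0. E t \<ge> - C"
proof -
  obtain T where T: "\<And>t. t \<ge> T \<Longrightarrow> E t \<ge> 0" using assms(2) by (auto simp: eventually_at_top_linorder)
  have "compact (E ` {0..max 0 T})"
    by (rule compact_continuous_image[OF continuous_on_subset[OF assms(1)]]) auto
  then obtain B where "\<forall>y\<in>E ` {0..max 0 T}. \<bar>y\<bar> \<le> B"
    using compact_imp_bounded bounded_real by blast
  then have "E t \<ge> - \<bar>B\<bar>" if "t \<ge> 0" for t
    using T[of t] that by (cases "t \<le> T") (force simp: abs_le_iff)+
  then show ?thesis by blast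
qed

lemma antiderivative_exists:
  fixes s :: "real \<Rightarrow> real"
  assumes "continuous_on UNIV s"
  shows "\<exists>G. G 0 = 0 \<and> (\<forall>t. (G has_real_derivative s t) (at t))"
proof -
  have "\<exists>F. \<forall>x::real. - \<infinity> < ereal x \<longrightarrow> ereal x < \<infinity> \<longrightarrow> (F has_vector_derivative s x) (at x)"
    by (rule einterval_antiderivative) (use assms in \<open>auto simp: continuous_on_eq_continuous_at\<close>)
  then obtain F where F: "\<And>x. (F has_real_derivative s x) (at x)"
    by (auto simp: has_real_derivative_iff_has_vector_derivative)
  have "((\<lambda>x. F x - F 0) has_real_derivative s x) (at x)" for x
    using DERIV_diff[OF F[of x] DERIV_const[of "F 0"]] by simp
  then show ?thesis by (intro exI[of _ "\<lambda>x. F x - F 0"]) auto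
qed

locale superlinear_convex =
  fixes f f' f'' :: "real \<Rightarrow> real"
  assumes C2: "C2_nonneg f f' f''" and convex: "convex_on {0..} f" and pos0: "f 0 > 0"
    and f'_nonneg: "\<And>t. t \<ge> 0 \<Longrightarrow> f' t \<ge> 0"
    and superlinear: "filterlim (\<lambda>s. f s / s) at_top at_top"
begin

lemma Df: "t \<ge> 0 \<Longrightarrow> (f has_real_derivative f' t) (at t within {0..})"
  and Df': "t \<ge> 0 \<Longrightarrow> (f' has_real_derivative f'' t) (at t within {0..})"
  using C2 by (simp_all add: C2_nonneg_def)

lemma continuous_f: "continuous_on {0..} f" and continuous_f': "continuous_on {0..} f'"
  using Df Df' by (auto intro!: DERIV_continuous_on)

lemma f_mono: "0 \<le> s \<Longrightarrow> s \<le> t \<Longrightarrow> f s \<le> f t"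
  by (rule half_line_mono[OF Df]) (auto intro: f'_nonneg)

lemma f_pos: "t \<ge> 0 \<Longrightarrow> f t > 0"
  using f_mono[of 0 t] pos0 by simp

lemma tangent_below:
  assumes "t > 0" "r \<ge> 0"
  shows "f r \<ge> f t + f' t * (r - t)"
  using convex_on_imp_above_tangent[OF convex _ _ _ Df, of t r] assms by simp

lemma f'_mono: "0 < s \<Longrightarrow> s \<le> t \<Longrightarrow> f' s \<le> f' t"
proof (cases "s = t")
  case False
  assume "0 < s" "s \<le> t"
  then have "f t \<ge> f s + f' s * (t - s)" "f s \<ge> f t + f' t * (s - t)"
    by (auto intro!: tangent_below)
  then have "f' s * (t - s) \<le> f' t * (t - s)" by (simp add: algebra_simps)
  then show ?thesis using \<open>s \<le> t\<close> False by simp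
qed simp

lemma f''_nonneg:
  assumes "t > 0"
  shows "f'' t \<ge> 0"
proof (rule mono_on_imp_deriv_nonneg[of "{0<..}" f'])
  show "mono_on {0<..} f'" by (rule mono_onI) (auto intro: f'_mono)
  have "at t within {0..} = at t" using assms by (intro at_within_interior) auto
  then show "(f' has_real_derivative f'' t) (at t)" using Df'[of t] assms by simp
qed (use assms in \<open>auto simp: interior_open\<close>)

lemma eventually_f_ge: "eventually (\<lambda>t. f t \<ge> K * t) at_top"
proof -
  have "eventually (\<lambda>t. f t / t \<ge> K) at_top" using superlinear by (simp add: filterlim_at_top)
  then show ?thesis
    using eventually_gt_at_top[of 0] by eventually_elim (simp add: field_simps)
qed

lemma eventually_f_ge_const: "eventually (\<lambda>t. f t \<ge> K) at_top"
  using eventually_f_ge[of 1] eventually_ge_at_top[of K] by eventually_elim simp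

text \<open>The tangent at \<open>t\<close> lies below \<open>f 0\<close> at the origin, that is \<open>t f' t \<ge> f t - f 0\<close>, so \<open>f'\<close>
  inherits the divergence of \<open>f t / t\<close>.\<close>

lemma eventually_f'_ge: "eventually (\<lambda>t. f' t \<ge> K) at_top"
  using eventually_f_ge[of "K + f 0"] eventually_ge_at_top[of 1]
proof eventually_elim
  case (elim t)
  have "f 0 \<ge> f t + f' t * (0 - t)" using elim by (intro tangent_below) auto
  then have "K * t + f 0 * t \<le> f' t * t + f 0" using elim by (simp add: algebra_simps)
  moreover have "f 0 \<le> f 0 * t" using elim pos0 by simp
  ultimately have "K * t \<le> f' t * t" by linarith
  then show ?case using elim by simp
qed

text \<open>What is required of a profile \<open>g\<close>: semistability tested with \<open>g \<circ> u\<close> and the equation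
  tested with \<open>h \<circ> u\<close> have the same energy term, and the difference of the zeroth order terms
  controls \<open>t * f t\<close>. The function \<open>h\<close> is determined by \<open>g'\<close>.\<close>

definition coercive_profile :: "(real \<Rightarrow> real) \<Rightarrow> (real \<Rightarrow> real) \<Rightarrow> (real \<Rightarrow> real) \<Rightarrow> bool" where
  "coercive_profile g g' h \<longleftrightarrow>
     continuous_on {0..} g' \<and> g 0 = 0 \<and> h 0 = 0 \<and>
     (\<forall>t\<ge>0. (g has_real_derivative g' t) (at t within {0..})) \<and>
     (\<forall>t\<ge>0. (h has_real_derivative (g' t)\<^sup>2) (at t within {0..})) \<and>
     (\<exists>\<delta>>0. \<exists>C. \<forall>t\<ge>0. f' t * (g t)\<^sup>2 - f t * h t \<ge> \<delta> * (t * f t) - C)"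

lemma coercive_profileI:
  assumes g': "continuous_on {0..} g'" and "g 0 = 0"
    and Dg: "\<And>t. t \<ge> 0 \<Longrightarrow> (g has_real_derivative g' t) (at t within {0..})"
    and "\<delta> > 0"
    and ev: "\<And>h. h 0 = 0 \<Longrightarrow> (\<And>t. t \<ge> 0 \<Longrightarrow> (h has_real_derivative (g' t)\<^sup>2) (at t within {0..})) \<Longrightarrow>
       eventually (\<lambda>t. f' t * (g t)\<^sup>2 - f t * h t \<ge> \<delta> * (t * f t)) at_top"
  shows "\<exists>g g' h. coercive_profile g g' h"
proof -
  \<comment> \<open>\<open>g'\<close> is extended by a constant to the negative axis to have a primitive on the whole line\<close>
  have "continuous_on UNIV (\<lambda>t. (g' (max 0 t))\<^sup>2)"
    by (intro continuous_on_power continuous_on_compose2[OF g']) (auto intro!: continuous_intros)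
  then obtain h where h: "h 0 = 0" "\<And>t. (h has_real_derivative (g' (max 0 t))\<^sup>2) (at t)"
    using antiderivative_exists by metis
  have Dh: "(h has_real_derivative (g' t)\<^sup>2) (at t within {0..})" if "t \<ge> 0" for t
    using has_field_derivative_at_within[OF h(2)[of t]] that by (simp add: max_absorb2)
  have cont: "continuous_on {0..} g" "continuous_on {0..} h"
    using Dg Dh by (auto intro!: DERIV_continuous_on)
  have "\<exists>C. \<forall>t\<ge>0. f' t * (g t)\<^sup>2 - f t * h t - \<delta> * (t * f t) \<ge> - C"
  proof (rule half_line_bounded_below)
    show "continuous_on {0..} (\<lambda>t. f' t * (g t)\<^sup>2 - f t * h t - \<delta> * (t * f t))"
      by (intro continuous_intros cont continuous_f continuous_f')
    show "eventually (\<lambda>t. f' t * (g t)\<^sup>2 - f t * h t - \<delta> * (t * f t) \<ge> 0) at_top"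
      using ev[OF h(1) Dh] by simp
  qed
  then have "\<exists>\<delta>>0. \<exists>C. \<forall>t\<ge>0. f' t * (g t)\<^sup>2 - f t * h t \<ge> \<delta> * (t * f t) - C"
    using \<open>\<delta> > 0\<close> by (force simp: algebra_simps)
  then show ?thesis
    using assms(1-3) h(1) Dh unfolding coercive_profile_def by blast
qed

text \<open>Write \<open>g = f - f 0\<close> and \<open>F = f' g - h\<close>, so that \<open>F' = f'' g \<ge> 0\<close>. Two lower bounds for \<open>F\<close>
  are combined. For fixed \<open>s\<close> the growth of \<open>F\<close> beyond \<open>s\<close> is at least \<open>g s (f' t - f' s)\<close>,
  hence \<open>F \<ge> 2 f 0 f'\<close> eventually. And \<open>F + f 0 f'\<close> has the derivative \<open>f'' f\<close>, where \<open>f\<close> is at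
  least its tangent \<open>p (r - z)\<close> at \<open>t\<close>, with \<open>p = f' t\<close> and \<open>z = t - f t / f' t\<close>; since
  \<open>(r - z) f' r - f r\<close> is a primitive of \<open>(r - z) f'' r\<close>, the increment from \<open>z\<close> to \<open>t\<close> is
  at least \<open>p f z\<close>.\<close>

lemma coercive_profile_tangent_condition:
  assumes "\<epsilon> > 0"
    and cond: "\<And>t. t > T \<Longrightarrow> f' t > 0 \<and> t - f t / f' t \<ge> 0 \<and> f' t * f (t - f t / f' t) \<ge> \<epsilon> * t"
  shows "\<exists>g g' h. coercive_profile g g' h"
proof (rule coercive_profileI[where g="\<lambda>t. f t - f 0"])
  show "continuous_on {0..} f'" by (rule continuous_f')
  show "f 0 - f 0 = 0" by simp
  show "((\<lambda>t. f t - f 0) has_real_derivative f' t) (at t within {0..})" if "t \<ge> 0" for t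
    using DERIV_diff[OF Df[OF that] DERIV_const] by simp
  show "\<epsilon> / 6 > 0" using \<open>\<epsilon> > 0\<close> by simp
  fix h :: "real \<Rightarrow> real"
  assume h0: "h 0 = 0" and Dh: "\<And>t. t \<ge> 0 \<Longrightarrow> (h has_real_derivative (f' t)\<^sup>2) (at t within {0..})"
  define F where "F t = f' t * (f t - f 0) - h t" for t
  have DF: "(F has_real_derivative f'' t * (f t - f 0)) (at t within {0..})" if "t \<ge> 0" for t
    unfolding F_def
    by (rule derivative_eq_intros Df[OF that] Df'[OF that] Dh[OF that] refl)+
      (simp add: algebra_simps power2_eq_square)
  have F_nonneg: "F t \<ge> 0" if "t \<ge> 0" for t
  proof -
    have "F 0 \<le> F t"
      by (rule half_line_mono[OF DF]) (use that f_mono in \<open>auto intro!: mult_nonneg_nonneg f''_nonneg\<close>)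
    then show ?thesis by (simp add: F_def h0)
  qed
  have ev1: "eventually (\<lambda>t. F t \<ge> 2 * f 0 * f' t) at_top"
  proof -
    \<comment> \<open>\<open>g s \<ge> 4 f 0\<close> and \<open>f' t \<ge> 2 f' s\<close> together give the factor \<open>2 f 0\<close>\<close>
    obtain s where s: "s > 0" "f s \<ge> 5 * f 0"
      using eventually_happens'[OF _ eventually_conj[OF eventually_gt_at_top[of 0] eventually_f_ge_const[of "5 * f 0"]]]
      by auto
    show ?thesis
      using eventually_ge_at_top[of s] eventually_f'_ge[of "2 * f' s"]
    proof eventually_elim
      case (elim t)
      have "F s - (f s - f 0) * f' s \<le> F t - (f s - f 0) * f' t"
      proof (rule half_line_mono[where F="\<lambda>r. F r - (f s - f 0) * f' r"
            and F'="\<lambda>r. f'' r * (f r - f s)"])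
        show "((\<lambda>r. F r - (f s - f 0) * f' r) has_real_derivative f'' r * (f r - f s)) (at r within {0..})"
          if "r \<ge> 0" for r
          by (rule derivative_eq_intros DF[OF that] Df'[OF that] refl)+ (simp add: algebra_simps)
        show "f'' r * (f r - f s) \<ge> 0" if "s < r" "r < t" for r
          using that s f_mono[of s r] by (intro mult_nonneg_nonneg f''_nonneg) auto
      qed (use elim s in auto)
      then have "F t \<ge> (f s - f 0) * (f' t - f' s)"
        using F_nonneg[of s] s by (simp add: algebra_simps)
      moreover have "(f s - f 0) * (f' t - f' s) \<ge> (4 * f 0) * (f' t / 2)"
        using s elim f'_nonneg[of s] f'_nonneg[of t] pos0 by (intro mult_mono) auto
      ultimately show ?case by simp
    qed
  qed
  have ev2: "eventually (\<lambda>t. F t + f 0 * f' t \<ge> \<epsilon> * t) at_top"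
    using eventually_gt_at_top[of T] eventually_gt_at_top[of 0]
  proof eventually_elim
    case (elim t)
    define p where "p = f' t"
    define z where "z = t - f t / p"
    have p: "p > 0" and z: "z \<ge> 0" "p * f z \<ge> \<epsilon> * t" using cond[OF elim(1)] by (auto simp: p_def z_def)
    have pz: "p * (t - z) = f t" using p by (simp add: z_def)
    have zt: "z \<le> t" using p f_pos[of t] elim by (simp add: z_def)
    let ?Q = "\<lambda>r. F r + f 0 * f' r - p * ((r - z) * f' r - f r)"
    have "?Q z \<le> ?Q t"
    proof (rule half_line_mono[where F="?Q" and F'="\<lambda>r. f'' r * (f r - p * (r - z))"])
      show "(?Q has_real_derivative f'' r * (f r - p * (r - z))) (at r within {0..})" if "r \<ge> 0" for r
        by (rule derivative_eq_intros DF[OF that] Df[OF that] Df'[OF that] refl)+ (simp add: algebra_simps)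
      show "f'' r * (f r - p * (r - z)) \<ge> 0" if "z < r" "r < t" for r
      proof (rule mult_nonneg_nonneg)
        have "f r \<ge> f t + p * (r - t)" using tangent_below[of t r] elim that z by (simp add: p_def)
        then show "f r - p * (r - z) \<ge> 0" using pz by (simp add: algebra_simps)
      qed (use that z in \<open>auto intro: f''_nonneg\<close>)
    qed (use z zt in auto)
    moreover have "?Q t = F t + f 0 * f' t" using pz by (simp add: p_def algebra_simps)
    moreover have "?Q z = F z + f 0 * f' z + p * f z" by simp
    ultimately show ?case
      using z F_nonneg[of z] mult_nonneg_nonneg[of "f 0" "f' z"] pos0 f'_nonneg[of z] by linarith
  qed
  show "eventually (\<lambda>t. f' t * (f t - f 0)\<^sup>2 - f t * h t \<ge> \<epsilon> / 6 * (t * f t)) at_top"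
    using ev1 ev2 eventually_f_ge_const[of "2 * f 0"] eventually_gt_at_top[of 0]
  proof eventually_elim
    case (elim t)
    have "f' t * (f t - f 0)\<^sup>2 - f t * h t = (f t - f 0) * (F t - f 0 * f' t) + f 0 * F t"
      by (simp add: F_def algebra_simps power2_eq_square)
    moreover have "f 0 * F t \<ge> 0" using F_nonneg[of t] pos0 elim by simp
    moreover have "(f t - f 0) * (F t - f 0 * f' t) \<ge> (f t / 2) * (\<epsilon> * t / 3)"
    proof (rule mult_mono)
      show "\<epsilon> * t / 3 \<le> F t - f 0 * f' t" using elim by linarith
    qed (use elim pos0 \<open>\<epsilon> > 0\<close> in auto)
    ultimately show ?case by (simp add: algebra_simps)
  qed
qed

text \<open>The quantity to be bounded below is \<open>w = t f' - f\<close>, whose derivative is \<open>t f''\<close>. If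
  \<open>t f' \<ge> 2 f\<close>, then \<open>w \<ge> f\<close> and nothing is needed. Otherwise \<open>f\<close> does not drop below
  half of \<open>f t\<close> on \<open>[3 t / 4, t]\<close>, so the hypothesis bounds \<open>w'\<close> there from below by a
  multiple of \<open>f t / (t (ln t)\<^sup>\<gamma>)\<close>.\<close>

lemma coercive_profile_log_condition:
  assumes \<gamma>: "\<gamma> < 2" "0 < \<gamma>" and "c > 0" and "T > 1"
    and cond: "\<And>t. t > T \<Longrightarrow> f'' t / f t \<ge> c / (t\<^sup>2 * (ln t) powr \<gamma>)"
  shows "\<exists>g g' h. coercive_profile g g' h"
proof (rule coercive_profileI[where g="\<lambda>t. t * ln (1 + t)"])
  let ?L = "\<lambda>t::real. ln (1 + t)"
  let ?g' = "\<lambda>t::real. ln (1 + t) + t / (1 + t)"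
  show "continuous_on {0..} ?g'" by (auto intro!: continuous_intros)
  show "0 * ?L 0 = 0" by simp
  show "((\<lambda>t. t * ?L t) has_real_derivative ?g' t) (at t within {0..})" if "t \<ge> 0" for t
    using that by (auto intro!: derivative_eq_intros)
  show "(1::real) > 0" by simp
  fix h :: "real \<Rightarrow> real"
  assume h0: "h 0 = 0" and Dh: "\<And>t. t \<ge> 0 \<Longrightarrow> (h has_real_derivative (?g' t)\<^sup>2) (at t within {0..})"
  have h_le: "h t \<le> t * (?L t)\<^sup>2 + t" if "t \<ge> 0" for t
  proof -
    have "0 * (?L 0)\<^sup>2 + 0 - h 0 \<le> t * (?L t)\<^sup>2 + t - h t"
    proof (rule half_line_mono[where F="\<lambda>t. t * (?L t)\<^sup>2 + t - h t" and F'="\<lambda>r. 1 - (r / (1 + r))\<^sup>2"])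
      show "((\<lambda>t. t * (?L t)\<^sup>2 + t - h t) has_real_derivative 1 - (r / (1 + r))\<^sup>2) (at r within {0..})"
        if "r \<ge> 0" for r
      proof (rule DERIV_cong)
        have "((\<lambda>t. t * (?L t)\<^sup>2 + t) has_real_derivative
            (?L r)\<^sup>2 + r * (2 * ?L r * (1 / (1 + r))) + 1) (at r within {0..})"
          using that by (auto intro!: derivative_eq_intros)
        then show "((\<lambda>t. t * (?L t)\<^sup>2 + t - h t) has_real_derivative
            (?L r)\<^sup>2 + r * (2 * ?L r * (1 / (1 + r))) + 1 - (?g' r)\<^sup>2) (at r within {0..})"
          by (rule DERIV_diff[OF _ Dh[OF that]])
        show "(?L r)\<^sup>2 + r * (2 * ?L r * (1 / (1 + r))) + 1 - (?g' r)\<^sup>2 = 1 - (r / (1 + r))\<^sup>2"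
          by (simp add: power2_sum)
      qed
      show "1 - (r / (1 + r))\<^sup>2 \<ge> 0" if "0 < r" "r < t" for r
        using that power_le_one[of "r / (1 + r)" 2] by simp
    qed (use that in auto)
    then show ?thesis by (simp add: h0)
  qed
  define w where "w t = t * f' t - f t" for t
  have Dw: "(w has_real_derivative t * f'' t) (at t within {0..})" if "t \<ge> 0" for t
    unfolding w_def
    by (rule derivative_eq_intros Df[OF that] Df'[OF that] refl)+ (simp add: algebra_simps)
  have w_ge: "w t \<ge> - f 0" if "t \<ge> 0" for t
  proof -
    have "w 0 \<le> w t"
      by (rule half_line_mono[OF Dw]) (use that in \<open>auto intro!: mult_nonneg_nonneg f''_nonneg\<close>)
    then show ?thesis by (simp add: w_def)
  qed
  have w_step: "w t \<ge> c * f t / (8 * (ln t) powr \<gamma>) - f 0" if t: "3 / 4 * t > T" and small: "t * f' t \<le> 2 * f t" for t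
  proof -
    have t0: "t > 1" using t \<open>T > 1\<close> by simp
    obtain z where z: "3 / 4 * t < z" "z < t" and wz: "w t - w (3 / 4 * t) = z * f'' z * (t - 3 / 4 * t)"
      using half_line_mvt[OF Dw, of "3 / 4 * t" t] t0 by auto
    have z1: "z > 1" using z t \<open>T > 1\<close> by simp
    have "f z \<ge> f t + f' t * (z - t)" using t0 z1 by (intro tangent_below) auto
    moreover have "f' t * (t - z) \<le> f' t * (t / 4)"
      using z f'_nonneg[of t] t0 by (intro mult_left_mono) auto
    ultimately have fz: "f z \<ge> f t / 2" using small by (simp add: algebra_simps)
    have lnz: "0 < ln z" "ln z \<le> ln t" using z1 z by auto
    have "c / (z\<^sup>2 * (ln z) powr \<gamma>) * f z \<le> f'' z"
      using cond[of z] z t f_pos[of z] z1 by (simp add: pos_le_divide_eq)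
    then have "z * (c / (z\<^sup>2 * (ln z) powr \<gamma>) * f z) \<le> z * f'' z"
      using z1 by (intro mult_left_mono) auto
    then have "c * f z / (z * (ln z) powr \<gamma>) \<le> z * f'' z"
      using z1 by (simp add: power2_eq_square)
    moreover have "c * (f t / 2) / (t * (ln t) powr \<gamma>) \<le> c * f z / (z * (ln z) powr \<gamma>)"
      using fz z1 z lnz \<open>c > 0\<close> \<gamma> f_pos[of t] t0
      by (intro frac_le mult_mono powr_mono2 mult_left_mono mult_nonneg_nonneg mult_pos_pos) auto
    ultimately have "c * (f t / 2) / (t * (ln t) powr \<gamma>) \<le> z * f'' z" by linarith
    then have "c * (f t / 2) / (t * (ln t) powr \<gamma>) * (t / 4) \<le> z * f'' z * (t / 4)"
      using t0 by (intro mult_right_mono) auto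
    moreover have "c * (f t / 2) / (t * (ln t) powr \<gamma>) * (t / 4) = c * f t / (8 * (ln t) powr \<gamma>)"
      using t0 by (simp add: field_simps)
    moreover have "z * f'' z * (t / 4) = w t - w (3 / 4 * t)" using wz by simp
    ultimately show ?thesis using w_ge[of "3 / 4 * t"] t0 by simp
  qed
  have e1: "eventually (\<lambda>t::real. (ln t) powr (2 - \<gamma>) \<ge> 24 / c) at_top"
  proof -
    have "filterlim (\<lambda>t::real. (ln t) powr (2 - \<gamma>)) at_top at_top" using \<gamma> by real_asymp
    then show ?thesis by (simp add: filterlim_at_top)
  qed
  have e2: "eventually (\<lambda>t::real. f 0 * (ln (1 + t))\<^sup>2 \<le> t) at_top" using pos0 by real_asymp
  have e3: "eventually (\<lambda>t::real. (ln (1 + t))\<^sup>2 \<ge> 2) at_top" by real_asymp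
  show "eventually (\<lambda>t. f' t * (t * ?L t)\<^sup>2 - f t * h t \<ge> 1 * (t * f t)) at_top"
    using e1 e2 e3 eventually_gt_at_top[of "4 / 3 * T"] eventually_f_ge[of 1]
  proof eventually_elim
    case (elim t)
    have t: "3 / 4 * t > T" "t > 1" using elim \<open>T > 1\<close> by auto
    have ft: "f t > 0" using f_pos t by simp
    have "(?L t)\<^sup>2 * w t \<ge> 2 * f t"
    proof (cases "t * f' t \<le> 2 * f t")
      case False
      then have "2 * f t \<le> (?L t)\<^sup>2 * f t" using elim ft by (intro mult_right_mono) auto
      also have "\<dots> \<le> (?L t)\<^sup>2 * w t" using False by (intro mult_left_mono) (auto simp: w_def)
      finally show ?thesis .
    next
      case True
      have ln: "0 < ln t" "ln t \<le> ?L t" using t by auto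
      have "3 * f t = (c / 8) * (24 / c) * f t" using \<open>c > 0\<close> by simp
      also have "\<dots> \<le> (c / 8) * (ln t) powr (2 - \<gamma>) * f t"
        using elim \<open>c > 0\<close> ft by (intro mult_right_mono mult_left_mono) auto
      also have "\<dots> = (ln t)\<^sup>2 * (c * f t / (8 * (ln t) powr \<gamma>))"
        using ln by (simp add: powr_diff powr_numeral)
      also have "\<dots> \<le> (?L t)\<^sup>2 * (c * f t / (8 * (ln t) powr \<gamma>))"
        using ln \<open>c > 0\<close> ft by (intro mult_right_mono power_mono) auto
      also have "\<dots> \<le> (?L t)\<^sup>2 * (w t + f 0)"
        using w_step[OF t(1) True] by (intro mult_left_mono) auto
      finally show ?thesis using elim by (simp add: algebra_simps)
    qed
    then have "t * (2 * f t) \<le> t * ((?L t)\<^sup>2 * w t)" using t by simp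
    moreover have "f t * h t \<le> f t * (t * (?L t)\<^sup>2 + t)" using h_le[of t] t ft by simp
    ultimately show ?case by (simp add: w_def algebra_simps power2_eq_square)
  qed
qed

end

section \<open>The energy estimate\<close>

text \<open>Bounded smooth functions form an algebra; a sine of small frequency separates the points of the
  interval. Boundedness on the whole line is what makes the primitives admissible in the
  chain rule, since the test functions approximating \<open>u\<close> need not respect the bounds of \<open>u\<close>.\<close>

lemma smooth_bounded_approx:
  fixes s :: "real \<Rightarrow> real"
  assumes s: "continuous_on {0..b} s" and "b \<ge> 0" "e > 0"
  shows "\<exists>p. (smooth_on p UNIV \<and> (\<exists>K. \<forall>t. \<bar>p t\<bar> \<le> K)) \<and> (\<forall>t\<in>{0..b}. \<bar>s t - p t\<bar> < e)"
proof (rule Stone_Weierstrass_HOL[OF compact_Icc _ _ _ _ _ s \<open>e > 0\<close>])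
  fix c :: real
  show "smooth_on (\<lambda>x. c) UNIV \<and> (\<exists>K. \<forall>t::real. \<bar>c\<bar> \<le> K)" using smooth_on_const by auto
next
  fix f :: "real \<Rightarrow> real" assume "smooth_on f UNIV \<and> (\<exists>K. \<forall>t. \<bar>f t\<bar> \<le> K)"
  then show "continuous_on {0..b} f"
    using continuous_on_subset[OF smooth_on_continuous subset_UNIV] by blast
next
  fix f g :: "real \<Rightarrow> real"
  assume "(smooth_on f UNIV \<and> (\<exists>K. \<forall>t. \<bar>f t\<bar> \<le> K)) \<and> (smooth_on g UNIV \<and> (\<exists>K. \<forall>t. \<bar>g t\<bar> \<le> K))"
  then obtain K K' where fg: "smooth_on f UNIV" "smooth_on g UNIV"
    and K: "\<And>t. \<bar>f t\<bar> \<le> K" "\<And>t. \<bar>g t\<bar> \<le> K'" by blast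
  have "\<bar>f t + g t\<bar> \<le> K + K'" for t using K[of t] by linarith
  then show "smooth_on (\<lambda>x. f x + g x) UNIV \<and> (\<exists>K. \<forall>t. \<bar>f t + g t\<bar> \<le> K)"
    using smooth_on_add[OF fg] by blast
  have "\<bar>f t * g t\<bar> \<le> K * K'" for t
    unfolding abs_mult using K[of t] by (intro mult_mono) auto
  then show "smooth_on (\<lambda>x. f x * g x) UNIV \<and> (\<exists>K. \<forall>t. \<bar>f t * g t\<bar> \<le> K)"
    using smooth_on_mult[OF fg] by blast
next
  fix x y :: real assume xy: "x \<in> {0..b} \<and> y \<in> {0..b} \<and> x \<noteq> y"
  let ?p = "\<lambda>t. sin (1 / (b + 1) * t)"
  have "smooth_on ?p UNIV"
    by (rule smooth_on_compose[OF smooth_on_sin smooth_on_bounded_linear[OF bounded_linear_mult_right]])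
  moreover have "\<forall>t. \<bar>?p t\<bar> \<le> 1" by (simp add: abs_sin_le_one)
  moreover have "?p x \<noteq> ?p y"
  proof -
    have range: "0 \<le> 1 / (b + 1) * t \<and> 1 / (b + 1) * t \<le> pi / 2" if "t \<in> {0..b}" for t
    proof -
      have "1 / (b + 1) * t \<le> 1" using that \<open>b \<ge> 0\<close> by (simp add: divide_le_eq)
      moreover have "0 \<le> 1 / (b + 1) * t" using that \<open>b \<ge> 0\<close> by simp
      ultimately show ?thesis using pi_gt3 by linarith
    qed
    have "1 / (b + 1) * x = 1 / (b + 1) * y" if "?p x = ?p y"
      by (rule sin_inj_pi[OF _ _ _ _ that]) (use range[of x] range[of y] xy pi_gt_zero in linarith)+
    then show ?thesis using xy \<open>b \<ge> 0\<close> by auto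
  qed
  ultimately show "\<exists>f::real \<Rightarrow> real. (smooth_on f UNIV \<and> (\<exists>K. \<forall>t. \<bar>f t\<bar> \<le> K)) \<and> f x \<noteq> f y"
    by (intro exI[of _ ?p] exI[of _ "1::real"] conjI)
qed

lemma continuous_bounded_Icc:
  fixes f :: "real \<Rightarrow> real"
  assumes "continuous_on {0..} f"
  shows "\<exists>A\<ge>0. \<forall>t\<in>{0..b}. \<bar>f t\<bar> \<le> A"
proof -
  have "compact (f ` {0..b})"
    by (rule compact_continuous_image[OF continuous_on_subset[OF assms]]) auto
  then obtain A where A: "\<forall>y\<in>f ` {0..b}. \<bar>y\<bar> \<le> A"
    using compact_imp_bounded bounded_real by blast
  have "\<bar>f t\<bar> \<le> \<bar>A\<bar>" if "t \<in> {0..b}" for t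
    using bspec[OF A imageI[OF that]] by linarith
  then show ?thesis by (intro exI[of _ "\<bar>A\<bar>"]) simp
qed

lemma close_derivatives_close:
  fixes g G :: "real \<Rightarrow> real"
  assumes g: "\<And>t. t \<ge> 0 \<Longrightarrow> (g has_real_derivative g' t) (at t within {0..})"
    and G: "\<And>t. (G has_real_derivative G' t) (at t)"
    and "g 0 = 0" "G 0 = 0" and close: "\<And>t. t \<in> {0..b} \<Longrightarrow> \<bar>g' t - G' t\<bar> \<le> e" and t: "t \<in> {0..b}"
  shows "\<bar>g t - G t\<bar> \<le> e * b"
proof (cases "t = 0")
  case True
  have "e \<ge> 0" using close[OF t] by linarith
  then show ?thesis using True assms by simp
next
  case False
  have D: "((\<lambda>t. g t - G t) has_real_derivative g' t - G' t) (at t within {0..})" if "t \<ge> 0" for t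
    by (rule DERIV_diff[OF g[OF that] has_field_derivative_at_within[OF G]])
  obtain z where z: "0 < z" "z < t" "g t - G t - (g 0 - G 0) = (g' z - G' z) * (t - 0)"
    using half_line_mvt[OF D, of 0 t] t False by auto
  then have "\<bar>g t - G t\<bar> = \<bar>g' z - G' z\<bar> * t" using assms t by (simp add: abs_mult)
  also have "\<dots> \<le> e * b" using close[of z] z t by (intro mult_mono) auto
  finally show ?thesis .
qed

context superlinear_convex
begin

text \<open>Approximating \<open>g'\<close> within \<open>d\<close> on \<open>[0,b]\<close> changes \<open>g\<close> and \<open>h\<close> by at most \<open>e\<close>, and hence the
  coercivity inequality by at most \<open>1\<close>. The loss does not depend on \<open>b\<close>, which will be the bound
  of the solution, although the approximation does.\<close>

lemma smooth_profile:
  assumes prof: "coercive_profile g g' h" and "b \<ge> 0"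
  obtains G S H K where "smooth_on S UNIV" "\<And>t. \<bar>S t\<bar> \<le> K"
    "\<And>t. (G has_real_derivative S t) (at t)" "\<And>t. (H has_real_derivative (S t)\<^sup>2) (at t)"
    "G 0 = 0" "H 0 = 0"
    "\<And>t. t \<in> {0..b} \<Longrightarrow> f' t * (g t)\<^sup>2 - f t * h t - 1 \<le> f' t * (G t)\<^sup>2 - f t * H t"
proof -
  have g'c: "continuous_on {0..} g'" and g0: "g 0 = 0" and h0: "h 0 = 0"
    and Dg: "\<And>t. t \<ge> 0 \<Longrightarrow> (g has_real_derivative g' t) (at t within {0..})"
    and Dh: "\<And>t. t \<ge> 0 \<Longrightarrow> (h has_real_derivative (g' t)\<^sup>2) (at t within {0..})"
    using prof by (auto simp: coercive_profile_def)
  have gc: "continuous_on {0..} g" using Dg by (auto intro!: DERIV_continuous_on)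
  obtain A where A: "A \<ge> 0" "\<And>t. t \<in> {0..b} \<Longrightarrow> \<bar>g' t\<bar> \<le> A"
    using continuous_bounded_Icc[OF g'c] by metis
  obtain A0 where A0: "A0 \<ge> 0" "\<And>t. t \<in> {0..b} \<Longrightarrow> \<bar>g t\<bar> \<le> A0"
    using continuous_bounded_Icc[OF gc] by metis
  obtain F0 where F0: "F0 \<ge> 0" "\<And>t. t \<in> {0..b} \<Longrightarrow> \<bar>f t\<bar> \<le> F0"
    using continuous_bounded_Icc[OF continuous_f] by metis
  obtain F1 where F1: "F1 \<ge> 0" "\<And>t. t \<in> {0..b} \<Longrightarrow> \<bar>f' t\<bar> \<le> F1"
    using continuous_bounded_Icc[OF continuous_f'] by metis
  define e where "e = 1 / (F1 * (2 * A0 + 1) + F0 + 1)"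
  have den: "F1 * (2 * A0 + 1) + F0 \<ge> 0" using F0 F1 A0 by simp
  have e: "0 < e" "e \<le> 1" "e * (F1 * (2 * A0 + 1) + F0) \<le> 1" using den by (auto simp: e_def)
  \<comment> \<open>\<open>(g' + S) (g' - S)\<close> is at most \<open>(2 A + 1) d\<close>, integrated over a length of at most \<open>b\<close>\<close>
  define d where "d = e / ((2 * A + 1) * (b + 1))"
  have "(2 * A + 1) * (b + 1) \<ge> 1 * 1" using A \<open>b \<ge> 0\<close> by (intro mult_mono) auto
  then have d: "0 < d" "d \<le> 1" using e by (auto simp: d_def)
  have d2: "(2 * A + 1) * d * b \<le> e" "d * b \<le> e"
  proof -
    have "(2 * A + 1) * d * (b + 1) = e" using A \<open>b \<ge> 0\<close> by (simp add: d_def)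
    moreover have "(2 * A + 1) * d * b \<le> (2 * A + 1) * d * (b + 1)"
      using A d by (intro mult_left_mono) auto
    ultimately show *: "(2 * A + 1) * d * b \<le> e" by simp
    have "1 * (d * b) \<le> (2 * A + 1) * (d * b)" using A d \<open>b \<ge> 0\<close> by (intro mult_right_mono) auto
    then show "d * b \<le> e" using * by (simp add: mult.assoc)
  qed
  obtain S K where S: "smooth_on S UNIV" "\<And>t. \<bar>S t\<bar> \<le> K"
    and close: "\<And>t. t \<in> {0..b} \<Longrightarrow> \<bar>g' t - S t\<bar> < d"
    using smooth_bounded_approx[OF continuous_on_subset[OF g'c] \<open>b \<ge> 0\<close> d(1)] by (metis Icc_subset_Ici_iff order_refl)
  have Sc: "continuous_on UNIV S" by (rule smooth_on_continuous[OF S(1)])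
  obtain G where G: "G 0 = 0" "\<And>t. (G has_real_derivative S t) (at t)"
    using antiderivative_exists[OF Sc] by blast
  obtain H where H: "H 0 = 0" "\<And>t. (H has_real_derivative (S t)\<^sup>2) (at t)"
    using antiderivative_exists[OF continuous_on_power[OF Sc]] by blast
  have gG: "\<bar>g t - G t\<bar> \<le> e" if "t \<in> {0..b}" for t
  proof -
    have "\<bar>g t - G t\<bar> \<le> d * b"
      by (rule close_derivatives_close[OF Dg G(2) g0 G(1) less_imp_le[OF close] that])
    then show ?thesis using d2 by simp
  qed
  have hH: "\<bar>h t - H t\<bar> \<le> e" if "t \<in> {0..b}" for t
  proof -
    have sq: "\<bar>(g' r)\<^sup>2 - (S r)\<^sup>2\<bar> \<le> (2 * A + 1) * d" if "r \<in> {0..b}" for r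
    proof -
      have "(g' r)\<^sup>2 - (S r)\<^sup>2 = (g' r + S r) * (g' r - S r)" by (simp add: power2_eq_square algebra_simps)
      then have "\<bar>(g' r)\<^sup>2 - (S r)\<^sup>2\<bar> = \<bar>g' r + S r\<bar> * \<bar>g' r - S r\<bar>" by (simp add: abs_mult)
      also have "\<dots> \<le> (2 * A + 1) * d"
        using close[OF that] A(2)[OF that] A(1) d by (intro mult_mono) auto
      finally show ?thesis .
    qed
    have "\<bar>h t - H t\<bar> \<le> (2 * A + 1) * d * b"
      by (rule close_derivatives_close[OF Dh H(2) h0 H(1) sq that])
    then show ?thesis using d2 by simp
  qed
  have "f' t * (g t)\<^sup>2 - f t * h t - 1 \<le> f' t * (G t)\<^sup>2 - f t * H t" if t: "t \<in> {0..b}" for t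
  proof -
    have "(g t)\<^sup>2 - (G t)\<^sup>2 = (g t + G t) * (g t - G t)" by (simp add: power2_eq_square algebra_simps)
    then have "\<bar>(g t)\<^sup>2 - (G t)\<^sup>2\<bar> = \<bar>g t + G t\<bar> * \<bar>g t - G t\<bar>" by (simp add: abs_mult)
    also have "\<dots> \<le> (2 * A0 + 1) * e"
      using gG[OF t] A0(2)[OF t] A0(1) e by (intro mult_mono) auto
    finally have sq: "\<bar>(g t)\<^sup>2 - (G t)\<^sup>2\<bar> \<le> (2 * A0 + 1) * e" .
    have "\<bar>f' t * ((g t)\<^sup>2 - (G t)\<^sup>2)\<bar> \<le> F1 * ((2 * A0 + 1) * e)"
      unfolding abs_mult by (intro mult_mono F1(2)[OF t] sq F1(1)) simp
    moreover have "\<bar>f t * (h t - H t)\<bar> \<le> F0 * e"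
      unfolding abs_mult by (intro mult_mono F0(2)[OF t] hH[OF t] F0(1)) simp
    ultimately show ?thesis using e(3) by (simp add: algebra_simps)
  qed
  then show thesis by (intro that[of S K G H] S G H)
qed

lemma square_le_primitive: "\<exists>C. \<forall>t\<ge>0. t\<^sup>2 \<le> t * f t + C"
proof -
  have "\<exists>C. \<forall>t\<ge>0. t * f t - t\<^sup>2 \<ge> - C"
  proof (rule half_line_bounded_below)
    show "continuous_on {0..} (\<lambda>t. t * f t - t\<^sup>2)" by (intro continuous_intros continuous_f)
    show "eventually (\<lambda>t. t * f t - t\<^sup>2 \<ge> 0) at_top"
      using eventually_f_ge[of 1] eventually_ge_at_top[of 0]
      by eventually_elim (simp add: power2_eq_square mult_left_mono)
  qed
  then show ?thesis by (force simp: algebra_simps)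
qed

end

locale semilinear_problem = bounded_open \<Omega> + superlinear_convex f f' f''
  for \<Omega> :: "(real^'n) set" and f f' f'' :: "real \<Rightarrow> real" +
  fixes a :: "real^'n \<Rightarrow> real^'n^'n"
  assumes coeffs: "elliptic_coeffs \<Omega> a"
begin

text \<open>Replacing \<open>u\<close> by \<open>max 0 u\<close> gives a measurable representative, as \<open>k\<close> is arbitrary on the
  negative axis.\<close>

lemma integrable_continuous_compose:
  fixes k :: "real \<Rightarrow> real"
  assumes k: "continuous_on {0..} k" and u: "u \<in> borel_measurable M"
    and pos: "AE x in M. u x > 0" and bdd: "AE x in M. \<bar>u x\<bar> \<le> b"
  shows "integrable M (\<lambda>x. k (u x))"
proof -
  obtain A where A: "\<And>t. t \<in> {0..b} \<Longrightarrow> \<bar>k t\<bar> \<le> A" using continuous_bounded_Icc[OF k] by metis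
  have "continuous_on UNIV (\<lambda>t. k (max 0 t))"
    by (intro continuous_on_compose2[OF k]) (auto intro!: continuous_intros)
  then have "(\<lambda>t. k (max 0 t)) \<in> borel_measurable borel" by (rule borel_measurable_continuous_onI)
  then have "(\<lambda>x. k (max 0 (u x))) \<in> borel_measurable M" by (rule measurable_compose[OF u])
  moreover have "AE x in M. k (max 0 (u x)) = k (u x)" using pos by eventually_elim (simp add: max_absorb2)
  ultimately have "(\<lambda>x. k (u x)) \<in> borel_measurable M" by (rule borel_measurable_AE_cong)
  moreover have "AE x in M. norm (k (u x)) \<le> A" using pos bdd by eventually_elim (use A in auto)
  ultimately show ?thesis by (intro M.integrable_const_bound)
qed

lemma energy_density_measurable:
  assumes "\<And>i. (\<lambda>x. w x $ i) \<in> borel_measurable M"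
  shows "(\<lambda>x. w x \<bullet> (a x *v w x)) \<in> borel_measurable M"
proof -
  have "(\<lambda>x. a x $ i $ j) \<in> borel_measurable M" for i j
    using coeffs by (simp add: elliptic_coeffs_def Linf_def)
  then show ?thesis
    unfolding inner_vec_def matrix_vector_mult_def using assms by simp
qed

text \<open>Both sides are compared with the common energy \<open>\<integral> S(u)\<^sup>2 \<nabla>u \<bullet> a \<nabla>u\<close>.\<close>

lemma semistable_test_inequality:
  assumes sol: "weak_solution \<Omega> a f u" and stable: "semistable \<Omega> a f' u"
    and S: "smooth_on S UNIV" "\<And>t. \<bar>S t\<bar> \<le> K" and G0: "G 0 = 0" and H0: "H 0 = 0"
    and DG: "\<And>t. (G has_real_derivative S t) (at t)"
    and DH: "\<And>t. (H has_real_derivative (S t)\<^sup>2) (at t)"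
  shows "(LINT x|M. f' (u x) * (G (u x))\<^sup>2) \<le> (LINT x|M. f (u x) * H (u x))"
proof -
  have u: "u \<in> H10 \<Omega>" using sol by (simp add: weak_solution_def)
  then have uH1: "u \<in> H1 \<Omega>" by (simp add: H10_def)
  let ?w = "weak_gradient \<Omega> u" and ?wG = "weak_gradient \<Omega> (\<lambda>x. G (u x))"
    and ?wH = "weak_gradient \<Omega> (\<lambda>x. H (u x))"
  have Sc: "continuous_on UNIV S" by (rule smooth_on_continuous[OF S(1)])
  have S2: "smooth_on (\<lambda>t. (S t)\<^sup>2) UNIV" unfolding power2_eq_square by (rule smooth_on_mult[OF S(1) S(1)])
  have "\<bar>(S t)\<^sup>2\<bar> \<le> K\<^sup>2" for t using power_mono[OF S(2)[of t], of 2] by simp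
  note cG = H10_compose[OF u smooth_on_DERIV_I[OF DG S(1)] G0 DG Sc S(2)]
    and cH = H10_compose[OF u smooth_on_DERIV_I[OF DH S2] H0 DH smooth_on_continuous[OF S2] this]
  have [measurable]: "S \<in> borel_measurable borel" using Sc by (rule borel_measurable_continuous_onI)
  have [measurable]: "u \<in> borel_measurable M" by (rule L2D(1)[OF H1D(1)[OF uH1]])
  have [measurable]: "(\<lambda>x. ?w x \<bullet> (a x *v ?w x)) \<in> borel_measurable M"
    by (rule energy_density_measurable[OF L2D(1)[OF H1D(3)[OF uH1]]])
  have q: "(\<lambda>x. (S (u x))\<^sup>2 * (?w x \<bullet> (a x *v ?w x))) \<in> borel_measurable M" by measurable
  have "(LINT x|M. f' (u x) * (G (u x))\<^sup>2) \<le> (LINT x|M. ?wG x \<bullet> (a x *v ?wG x))"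
    using stable cG(1) by (simp add: semistable_def)
  also have "\<dots> = (LINT x|M. (S (u x))\<^sup>2 * (?w x \<bullet> (a x *v ?w x)))"
  proof (rule integral_AE_cong[OF q, symmetric])
    show "AE x in M. (S (u x))\<^sup>2 * (?w x \<bullet> (a x *v ?w x)) = ?wG x \<bullet> (a x *v ?wG x)"
      using cG(2) by eventually_elim (simp add: matrix_vector_mult_scaleR power2_eq_square)
  qed
  also have "\<dots> = (LINT x|M. ?wH x \<bullet> (a x *v ?w x))"
  proof (rule integral_AE_cong[OF q])
    show "AE x in M. (S (u x))\<^sup>2 * (?w x \<bullet> (a x *v ?w x)) = ?wH x \<bullet> (a x *v ?w x)"
      using cH(2) by eventually_elim simp
  qed
  also have "\<dots> = (LINT x|M. f (u x) * H (u x))"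
    using sol cH(1) by (simp add: weak_solution_def)
  finally show ?thesis .
qed

text \<open>The constants \<open>\<delta>\<close>, \<open>C1\<close>, \<open>C2\<close>, \<open>c0\<close> are fixed before \<open>u\<close>; only the smooth approximation of the
  profile depends on \<open>u\<close>, through its supremum.\<close>

lemma H1_bound_if_coercive_profile:
  assumes prof: "coercive_profile g g' h"
  shows "\<exists>C. \<forall>u. weak_solution \<Omega> a f u \<and> (AE x in M. u x > 0) \<and> semistable \<Omega> a f' u
           \<longrightarrow> H1_norm \<Omega> u \<le> C"
proof -
  obtain \<delta> C1 where \<delta>: "\<delta> > 0"
    and coercive: "\<And>t. t \<ge> 0 \<Longrightarrow> f' t * (g t)\<^sup>2 - f t * h t \<ge> \<delta> * (t * f t) - C1"
    using prof unfolding coercive_profile_def by blast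
  obtain C2 where C2: "\<And>t. t \<ge> 0 \<Longrightarrow> t\<^sup>2 \<le> t * f t + C2" using square_le_primitive by blast
  obtain c0 C0 where c0: "c0 > 0" and C0: "C0 > 0"
    and ell: "AE x in M. \<forall>\<xi>. c0 * (norm \<xi>)\<^sup>2 \<le> \<xi> \<bullet> (a x *v \<xi>) \<and> \<xi> \<bullet> (a x *v \<xi>) \<le> C0 * (norm \<xi>)\<^sup>2"
    using coeffs unfolding elliptic_coeffs_def by blast
  define vol where "vol = measure M (space M)"
  define A where "A = (C1 + 1) * vol / \<delta>"
  have "H1_norm \<Omega> u \<le> sqrt (A + C2 * vol + A / c0)"
    if sol: "weak_solution \<Omega> a f u" and pos: "AE x in M. u x > 0" and stable: "semistable \<Omega> a f' u" for u
  proof -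
    have u: "u \<in> H10 \<Omega>" and "u \<in> Linf \<Omega>" using sol by (simp_all add: weak_solution_def)
    then obtain b0 where "AE x in M. \<bar>u x\<bar> \<le> b0" by (auto simp: Linf_def)
    then have bdd: "AE x in M. \<bar>u x\<bar> \<le> \<bar>b0\<bar>" by eventually_elim simp
    have uH1: "u \<in> H1 \<Omega>" using u by (simp add: H10_def)
    note um = L2D[OF H1D(1)[OF uH1]] and wL2 = H1D(3)[OF uH1]
    let ?w = "weak_gradient \<Omega> u"
    obtain G S H K where S: "smooth_on S UNIV" "\<And>t. \<bar>S t\<bar> \<le> K"
      and DG: "\<And>t. (G has_real_derivative S t) (at t)"
      and DH: "\<And>t. (H has_real_derivative (S t)\<^sup>2) (at t)"
      and G0: "G 0 = 0" and H0: "H 0 = 0"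
      and GH: "\<And>t. t \<in> {0..\<bar>b0\<bar>} \<Longrightarrow> f' t * (g t)\<^sup>2 - f t * h t - 1 \<le> f' t * (G t)\<^sup>2 - f t * H t"
      by (rule smooth_profile[OF prof abs_ge_zero[of b0]]) (rule that)
    have Gc: "continuous_on {0..} G" and Hc: "continuous_on {0..} H"
      by (rule DERIV_continuous_on[OF has_field_derivative_at_within[OF DG]],
        rule DERIV_continuous_on[OF has_field_derivative_at_within[OF DH]])
    note int = integrable_continuous_compose[OF _ um(1) pos bdd]
    have i1: "integrable M (\<lambda>x. f' (u x) * (G (u x))\<^sup>2)"
      by (rule int[of "\<lambda>t. f' t * (G t)\<^sup>2"]) (intro continuous_intros continuous_f' Gc)
    have i2: "integrable M (\<lambda>x. f (u x) * H (u x))"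
      by (rule int[of "\<lambda>t. f t * H t"]) (intro continuous_intros continuous_f Hc)
    have i3: "integrable M (\<lambda>x. u x * f (u x))"
      by (rule int[of "\<lambda>t. t * f t"]) (intro continuous_intros continuous_f)
    have "(LINT x|M. \<delta> * (u x * f (u x)) - (C1 + 1))
        \<le> (LINT x|M. f' (u x) * (G (u x))\<^sup>2 - f (u x) * H (u x))"
    proof (rule integral_mono_AE)
      show "AE x in M. \<delta> * (u x * f (u x)) - (C1 + 1) \<le> f' (u x) * (G (u x))\<^sup>2 - f (u x) * H (u x)"
        using pos bdd
      proof eventually_elim
        case (elim x)
        then show ?case using coercive[of "u x"] GH[of "u x"] by force
      qed
    qed (use i1 i2 i3 in auto)
    also have "\<dots> \<le> 0"
      using semistable_test_inequality[OF sol stable S G0 H0 DG DH] i1 i2 by simp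
    finally have "\<delta> * (LINT x|M. u x * f (u x)) \<le> (C1 + 1) * vol"
      using i3 by (simp add: vol_def mult.commute)
    then have uf: "(LINT x|M. u x * f (u x)) \<le> A"
      using \<delta> by (simp add: A_def pos_le_divide_eq mult.commute)
    have "(LINT x|M. (u x)\<^sup>2) \<le> (LINT x|M. u x * f (u x) + C2)"
    proof (rule integral_mono_AE)
      show "AE x in M. (u x)\<^sup>2 \<le> u x * f (u x) + C2" using pos by eventually_elim (simp add: C2)
    qed (use i3 um(2) in auto)
    also have "\<dots> = (LINT x|M. u x * f (u x)) + C2 * vol" using i3 by (simp add: vol_def mult.commute)
    finally have u2: "(LINT x|M. (u x)\<^sup>2) \<le> A + C2 * vol" using uf by simp
    have w2: "integrable M (\<lambda>x. (norm (?w x))\<^sup>2)"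
      unfolding norm_vec_power2 by (intro Bochner_Integration.integrable_sum L2D(2) wL2)
    have q: "integrable M (\<lambda>x. ?w x \<bullet> (a x *v ?w x))"
    proof (rule Bochner_Integration.integrable_bound)
      show "integrable M (\<lambda>x. C0 * (norm (?w x))\<^sup>2)" using w2 by simp
      show "(\<lambda>x. ?w x \<bullet> (a x *v ?w x)) \<in> borel_measurable M"
        by (rule energy_density_measurable[OF L2D(1)[OF wL2]])
      show "AE x in M. norm (?w x \<bullet> (a x *v ?w x)) \<le> norm (C0 * (norm (?w x))\<^sup>2)"
        using ell
      proof eventually_elim
        case (elim x)
        have "0 \<le> c0 * (norm (?w x))\<^sup>2" using c0 by simp
        then show ?case using elim[rule_format, of "?w x"] by simp
      qed
    qed
    have "(LINT x|M. c0 * (norm (?w x))\<^sup>2) \<le> (LINT x|M. ?w x \<bullet> (a x *v ?w x))"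
      by (rule integral_mono_AE) (use w2 q ell in \<open>auto elim!: eventually_mono\<close>)
    also have "\<dots> = (LINT x|M. f (u x) * u x)" using sol u by (simp add: weak_solution_def)
    also have "\<dots> \<le> A" using uf by (simp add: mult.commute)
    finally have "(LINT x|M. (norm (?w x))\<^sup>2) \<le> A / c0"
      using c0 by (simp add: pos_le_divide_eq mult.commute)
    then show ?thesis using u2 unfolding H1_norm_def by (intro real_sqrt_le_mono) simp
  qed
  then show ?thesis by blast
qed

end

theorem proposition1p4:
  fixes \<Omega> :: "(real^'n) set"
    and a :: "real^'n \<Rightarrow> real^'n^'n"
    and f f' f'' :: "real \<Rightarrow> real"
  assumes "CARD('n) \<ge> 2"
    and "smooth_bounded_domain \<Omega>"
    and "elliptic_coeffs \<Omega> a"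
    and "C2_nonneg f f' f''"
    and "convex_on {0..} f"
    and "f 0 > 0"
    and "\<forall>t\<ge>0. f' t \<ge> 0"
    and "filterlim (\<lambda>s. f s / s) at_top at_top"
    and "(\<exists>\<epsilon>>0. \<exists>T>0. \<forall>t>T. f' t > 0 \<and> t - f t / f' t \<ge> 0 \<and>
            f' t * f (t - f t / f' t) \<ge> \<epsilon> * t) \<or>
         (\<exists>\<gamma>. 0 < \<gamma> \<and> \<gamma> < 2 \<and> (\<exists>C\<^sub>\<gamma>>0. \<exists>T>1. \<forall>t>T.
            f'' t / f t \<ge> C\<^sub>\<gamma> / (t\<^sup>2 * (ln t) powr \<gamma>)))"
  shows "\<exists>C. \<forall>u. weak_solution \<Omega> a f u \<and> (AE x in lebesgue_on \<Omega>. u x > 0) \<and>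
           semistable \<Omega> a f' u \<longrightarrow> H1_norm \<Omega> u \<le> C"
proof -
  interpret semilinear_problem \<Omega> f f' f'' a
    by unfold_locales (use assms in \<open>auto simp: smooth_bounded_domain_def\<close>)
  have "\<exists>g g' h. coercive_profile g g' h"
    using assms(9)
  proof (elim disjE exE conjE)
    fix \<epsilon> T
    assume "0 < \<epsilon>" "\<forall>t>T. f' t > 0 \<and> t - f t / f' t \<ge> 0 \<and> f' t * f (t - f t / f' t) \<ge> \<epsilon> * t"
    then show ?thesis by (intro coercive_profile_tangent_condition[of \<epsilon> T]) auto
  next
    fix \<gamma> c T
    assume "0 < \<gamma>" "\<gamma> < 2" "0 < c" "1 < T" "\<forall>t>T. f'' t / f t \<ge> c / (t\<^sup>2 * (ln t) powr \<gamma>)"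
    then show ?thesis by (intro coercive_profile_log_condition[of \<gamma> c T]) auto
  qed
  then show ?thesis using H1_bound_if_coercive_profile by blast
qed

end
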